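(* Let $(\mathbf{x}^n)_{n\ge 0}$ be a sequence of elements of $\{-1,+1\}^{\mathbb N}$, $\mathbf{x}^n=(\mathrm x^n_i)_{i\ge1}$. Suppose that there exists $\mathbf{x}=(\mathrm x_i)_{i\ge 1}\in\{-1,+1\}^{\mathbb N}$ such that $\tau(\mathbf{x})=\infty$ and such that for every $i\ge 1$, $\mathrm x^n_i=\mathrm x_i$ for all $n$ large enough. Then the following assertions are equivalent: (I) The sequence of trees $(\mathcal T_n(\mathbf{x}^n))_{n\ge 0}$ converges locally, in distribution. (II) The sequence of trees $(\mathcal T_n(\mathbf{x}))_{n\ge 0}$ converges locally, almost surely, towards a limit denoted by $\mathcal T_\infty(\mathbf{x})$. (III) The sum $\sum_{i\ge 1}\frac{1}{S_i(\mathbf{x})}\mathbf 1_{\{\mathrm x_i=-1\}}$ diverges. Moreover, in this case $\mathcal T_\infty(\mathbf{x})$ is the local limit (in distribution) of $(\mathcal T_n(\mathbf{x}^n))_{n\ge 0}$.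
   Context: $\mathbb N=\{1,2,3,\dots\}$. For $\mathbf{x}=(\mathrm x_i)_{i\ge1}\in\{-1,+1\}^{\mathbb N}$ set $S_0(\mathbf{x})=1$, $S_n(\mathbf{x})=1+\sum_{i=1}^n \mathrm x_i$ for $n\ge1$, and $\tau(\mathbf{x})=\inf\{n\ge1: S_n(\mathbf{x})=0\}$ (with $\inf\varnothing=\infty$). Uniform attachment with freezing (Algorithm 1). Given $\mathbf{x}$, random rooted, vertex-labelled, edge-labelled trees $(\mathcal T_n(\mathbf{x}))_{n\ge0}$ are built jointly and recursively as follows. $\mathcal T_0(\mathbf{x})$ is a single root vertex labelled $a$. For $n\ge1$, if $\mathcal T_{n-1}(\mathbf{x})$ has no vertex labelled $a$, set $\mathcal T_n(\mathbf{x})=\mathcal T_{n-1}(\mathbf{x})$. Otherwise let $V_n$ be a uniformly random vertex labelled $a$ (an "active" vertex) of $\mathcal T_{n-1}(\mathbf{x})$, chosen independently of the previous choices; if $\mathrm x_n=-1$, $\mathcal T_n(\mathbf{x})$ is obtained by replacing the label $a$ of $V_n$ by the label $n$ (the vertex is then "frozen"); if $\mathrm x_n=+1$, $\mathcal T_n(\mathbf{x})$ is obtained by adding an edge labelled $n$ between $V_n$ and a new vertex labelled $a$. Local topology. Let $\mathfrak T$ be the set of all rooted, vertex-labelled, edge-labelled, locally finite trees (every vertex has finite degree). For $t\in\mathfrak T$ and $h\in\mathbb N$, let $[t]_h$ be the finite rooted labelled tree obtained by keeping only the vertices at distance at most $h$ from the root, together with the edges between them and all these labels. $\mathfrak T$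 is equipped with a metric making it a Polish space for which $t_n\to t$ if and only if, for every $h\ge1$, $[t_n]_h=[t]_h$ (as rooted, vertex-labelled, edge-labelled trees) for all $n$ large enough. "Converges locally" means convergence in $\mathfrak T$ for this topology. *)

theory Defs
  imports "HOL-Probability.Probability" "HOL-Library.Extended_Nat"
begin

text \<open>The constructor \<open>Active\<close> is the label \<open>a\<close>; a frozen vertex is labelled by its freezing time.\<close>

datatype label = Active | Frozen nat

text \<open>A locally finite tree is countable, so up to isomorphism its vertices can be taken in
  \<open>nat\<close>. The values of \<open>vlabel\<close> outside \<open>verts\<close> and of \<open>elabel\<close> outside \<open>edges\<close> are irrelevant.\<close>

record lgraph =
  verts :: "nat set"
  root_of :: nat
  edges :: "nat set set"
  vlabel :: "nat \<Rightarrow> label"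
  elabel :: "nat set \<Rightarrow> nat"

definition is_path :: "lgraph \<Rightarrow> nat list \<Rightarrow> nat \<Rightarrow> nat \<Rightarrow> bool" where
  "is_path t p u v \<longleftrightarrow> p \<noteq> [] \<and> hd p = u \<and> last p = v \<and> distinct p \<and> set p \<subseteq> verts t \<and>
     successively (\<lambda>a b. {a, b} \<in> edges t) p"

definition locally_finite_tree :: "lgraph \<Rightarrow> bool" where
  "locally_finite_tree t \<longleftrightarrow>
     root_of t \<in> verts t \<and>
     (\<forall>e\<in>edges t. \<exists>u\<in>verts t. \<exists>v\<in>verts t. u \<noteq> v \<and> e = {u, v}) \<and>
     (\<forall>u\<in>verts t. \<forall>v\<in>verts t. \<exists>!p. is_path t p u v) \<and>
     (\<forall>u\<in>verts t. finite {v. {u, v} \<in> edges t})"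

definition is_iso :: "(nat \<Rightarrow> nat) \<Rightarrow> lgraph \<Rightarrow> lgraph \<Rightarrow> bool" where
  "is_iso f s t \<longleftrightarrow> bij_betw f (verts s) (verts t) \<and> f (root_of s) = root_of t \<and>
     (\<forall>u\<in>verts s. vlabel t (f u) = vlabel s u) \<and>
     (\<forall>u\<in>verts s. \<forall>v\<in>verts s. {f u, f v} \<in> edges t \<longleftrightarrow> {u, v} \<in> edges s) \<and>
     (\<forall>u\<in>verts s. \<forall>v\<in>verts s. {u, v} \<in> edges s \<longrightarrow> elabel t {f u, f v} = elabel s {u, v})"

definition isomorphic :: "lgraph \<Rightarrow> lgraph \<Rightarrow> bool" where
  "isomorphic s t \<longleftrightarrow> (\<exists>f. is_iso f s t)"

definition depth :: "lgraph \<Rightarrow> nat \<Rightarrow> nat" where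
  "depth t v = (LEAST k. \<exists>p. is_path t p (root_of t) v \<and> length p = Suc k)"

definition ball_of :: "nat \<Rightarrow> lgraph \<Rightarrow> lgraph" where
  "ball_of h t = (let V = {v \<in> verts t. depth t v \<le> h} in
     t\<lparr>verts := V, edges := {e \<in> edges t. e \<subseteq> V}\<rparr>)"

definition single_vertex :: lgraph where
  "single_vertex = \<lparr>verts = {0}, root_of = 0, edges = {}, vlabel = (\<lambda>_. Active), elabel = (\<lambda>_. 0)\<rparr>"

lemma isomorphic_refl: "isomorphic t t"
  unfolding isomorphic_def is_iso_def by (rule exI[of _ "\<lambda>x. x"]) (auto simp: bij_betw_def)

lemma is_iso_inv:
  assumes f: "is_iso f s t" and r: "root_of s \<in> verts s"
  shows "is_iso (inv_into (verts s) f) t s"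
proof -
  let ?g = "inv_into (verts s) f"
  have b: "bij_betw f (verts s) (verts t)" and im: "f ` verts s = verts t"
    and inj: "inj_on f (verts s)"
    using f by (auto simp: is_iso_def bij_betw_def)
  have gin: "\<And>v. v \<in> verts t \<Longrightarrow> ?g v \<in> verts s"
    and fg: "\<And>v. v \<in> verts t \<Longrightarrow> f (?g v) = v"
    using im by (auto simp: inv_into_into f_inv_into_f)
  have lab: "\<And>u. u \<in> verts s \<Longrightarrow> vlabel t (f u) = vlabel s u"
    and ed: "\<And>u v. u \<in> verts s \<Longrightarrow> v \<in> verts s \<Longrightarrow> {f u, f v} \<in> edges t \<longleftrightarrow> {u, v} \<in> edges s"
    and el: "\<And>u v. u \<in> verts s \<Longrightarrow> v \<in> verts s \<Longrightarrow> {u, v} \<in> edges s \<Longrightarrow>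
      elabel t {f u, f v} = elabel s {u, v}"
    using f by (auto simp: is_iso_def)
  have "f (root_of s) = root_of t" using f by (simp add: is_iso_def)
  then have "?g (root_of t) = root_of s"
    using inv_into_f_f[OF inj r] by simp
  moreover have "vlabel s (?g u) = vlabel t u" if "u \<in> verts t" for u
    using lab[OF gin[OF that]] fg[OF that] by simp
  moreover have "{?g u, ?g v} \<in> edges s \<longleftrightarrow> {u, v} \<in> edges t"
    if "u \<in> verts t" "v \<in> verts t" for u v
    using ed[OF gin gin, OF that] fg that by simp
  moreover have "elabel s {?g u, ?g v} = elabel t {u, v}"
    if "u \<in> verts t" "v \<in> verts t" "{u, v} \<in> edges t" for u v
    using ed[OF gin gin, OF that(1,2)] el[OF gin gin, OF that(1,2)] fg that by simp
  ultimately show ?thesis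
    using bij_betw_inv_into[OF b] by (simp add: is_iso_def)
qed

lemma isomorphic_sym:
  "isomorphic s t \<Longrightarrow> root_of s \<in> verts s \<Longrightarrow> isomorphic t s"
  unfolding isomorphic_def using is_iso_inv by blast

lemma isomorphic_trans:
  assumes "isomorphic s t" "isomorphic t u"
  shows "isomorphic s u"
proof -
  obtain f g where f: "is_iso f s t" and g: "is_iso g t u"
    using assms by (auto simp: isomorphic_def)
  have fin: "\<And>v. v \<in> verts s \<Longrightarrow> f v \<in> verts t"
    using f by (auto simp: is_iso_def bij_betw_def)
  have "is_iso (g \<circ> f) s u"
    unfolding is_iso_def
    using f g fin by (auto simp: is_iso_def bij_betw_trans)
  then show ?thesis by (auto simp: isomorphic_def)
qed

lemma is_path_map:
  assumes f: "is_iso f s t" and p: "is_path s p u v"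
  shows "is_path t (map f p) (f u) (f v)"
proof -
  have inj: "inj_on f (verts s)" and im: "f ` verts s = verts t"
    using f by (auto simp: is_iso_def bij_betw_def)
  have sub: "set p \<subseteq> verts s" using p by (simp add: is_path_def)
  have "successively (\<lambda>a b. {f a, f b} \<in> edges t) p"
    by (rule successively_mono[where P = "\<lambda>a b. {a, b} \<in> edges s"])
      (use p f sub in \<open>unfold is_path_def is_iso_def, blast+\<close>)
  then show ?thesis
    using p im inj_on_subset[OF inj sub]
    by (auto simp: is_path_def successively_map distinct_map hd_map last_map)
qed

lemma depth_iso:
  assumes f: "is_iso f s t" and r: "root_of s \<in> verts s" and v: "v \<in> verts s"
  shows "depth t (f v) = depth s v"
proof -
  let ?g = "inv_into (verts s) f"
  have g: "is_iso ?g t s" by (rule is_iso_inv[OF f r])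
  have rt: "f (root_of s) = root_of t" "?g (root_of t) = root_of s" using f g by (auto simp: is_iso_def)
  have gv: "?g (f v) = v" using f v by (auto simp: is_iso_def bij_betw_def)
  have "(\<exists>p. is_path t p (root_of t) (f v) \<and> length p = Suc k) \<longleftrightarrow>
        (\<exists>p. is_path s p (root_of s) v \<and> length p = Suc k)" for k
    using is_path_map[OF f, of _ "root_of s" v] is_path_map[OF g, of _ "root_of t" "f v"]
    by (metis gv length_map rt)
  then show ?thesis by (simp add: depth_def)
qed

lemma root_in_ball: "root_of t \<in> verts t \<Longrightarrow> root_of (ball_of h t) \<in> verts (ball_of h t)"
proof -
  assume "root_of t \<in> verts t"
  then have "is_path t [root_of t] (root_of t) (root_of t)" by (simp add: is_path_def)
  then have "depth t (root_of t) = 0"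
    unfolding depth_def by (intro Least_eq_0 exI[of _ "[root_of t]"]) simp
  then show ?thesis using \<open>root_of t \<in> verts t\<close> by (simp add: ball_of_def Let_def)
qed

lemma isomorphic_ball:
  assumes "isomorphic s t" and r: "root_of s \<in> verts s"
  shows "isomorphic (ball_of h s) (ball_of h t)"
proof -
  obtain f where f: "is_iso f s t" using assms by (auto simp: isomorphic_def)
  have inj: "inj_on f (verts s)" and im: "f ` verts s = verts t"
    using f by (auto simp: is_iso_def bij_betw_def)
  have d: "\<And>v. v \<in> verts s \<Longrightarrow> depth t (f v) = depth s v" by (rule depth_iso[OF f r])
  have "f ` {v \<in> verts s. depth s v \<le> h} = {v \<in> verts t. depth t v \<le> h}"
    unfolding im[symmetric] using d by auto
  then have "bij_betw f {v \<in> verts s. depth s v \<le> h} {v \<in> verts t. depth t v \<le> h}"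
    using inj by (auto simp: bij_betw_def inj_on_def)
  then have "is_iso f (ball_of h s) (ball_of h t)"
    using f d imageI[of _ "verts s" f] unfolding is_iso_def ball_of_def Let_def im[symmetric]
    by simp
  then show ?thesis by (auto simp: isomorphic_def)
qed

lemma single_vertex_tree: "locally_finite_tree single_vertex"
proof -
  have "is_path single_vertex p 0 0 \<longleftrightarrow> p = [0]" for p
  proof (cases p)
    case (Cons a q)
    then show ?thesis by (cases q) (auto simp: is_path_def single_vertex_def)
  qed (simp add: is_path_def)
  then show ?thesis by (simp add: locally_finite_tree_def) (simp add: single_vertex_def)
qed

text \<open>The set of rooted, vertex-labelled, edge-labelled, locally finite trees, where isomorphic
  trees are identified.\<close>

quotient_type ltree = lgraph / partial:
  "\<lambda>s t. locally_finite_tree s \<and> locally_finite_tree t \<and> isomorphic s t"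
  morphisms rep_ltree abs_ltree
proof (rule part_equivpI)
  show "\<exists>t. locally_finite_tree t \<and> locally_finite_tree t \<and> isomorphic t t"
    using single_vertex_tree isomorphic_refl by blast
qed (auto intro!: sympI transpI intro: isomorphic_sym isomorphic_trans simp: locally_finite_tree_def)

text \<open>The equality of balls \<open>[s]\<^sub>h = [t]\<^sub>h\<close> is isomorphism of the labelled graphs that
  represent them.\<close>

lift_definition ball_eq :: "nat \<Rightarrow> ltree \<Rightarrow> ltree \<Rightarrow> bool"
  is "\<lambda>h s t. isomorphic (ball_of h s) (ball_of h t)"
proof -
  fix h s s' t t'
  assume "locally_finite_tree s \<and> locally_finite_tree s' \<and> isomorphic s s'"
    "locally_finite_tree t \<and> locally_finite_tree t' \<and> isomorphic t t'"
  then have "isomorphic (ball_of h s) (ball_of h s')" "isomorphic (ball_of h t) (ball_of h t')"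
    and r: "root_of s \<in> verts s" "root_of t \<in> verts t"
    by (auto intro: isomorphic_ball simp: locally_finite_tree_def)
  moreover from this have "isomorphic (ball_of h s') (ball_of h s)"
    "isomorphic (ball_of h t') (ball_of h t)"
    by (blast intro: isomorphic_sym root_in_ball)+
  ultimately
  show "isomorphic (ball_of h s) (ball_of h t) = isomorphic (ball_of h s') (ball_of h t')"
    by (blast intro: isomorphic_trans)
qed

lemma ball_eq_refl: "ball_eq h t t"
  by transfer (simp add: isomorphic_refl)

lemma ball_eq_sym: "ball_eq h s t \<Longrightarrow> ball_eq h t s"
  by transfer (simp add: isomorphic_sym root_in_ball locally_finite_tree_def)

lemma ball_eq_trans: "ball_eq h s t \<Longrightarrow> ball_eq h t u \<Longrightarrow> ball_eq h s u"
  by transfer (metis isomorphic_trans)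

text \<open>The generating sets decrease in \<open>h\<close>, so the topology is first countable; it is therefore
  the topology of every metric that has the convergent sequences given by \<open>tendsto_ltree_iff\<close>.\<close>

instantiation ltree :: topological_space
begin

definition open_ltree :: "ltree set \<Rightarrow> bool" where
  "open_ltree = generate_topology {{s. ball_eq h s t} | h t. h \<ge> 1}"

instance
  by standard (auto simp: open_ltree_def intro: generate_topology.intros)

end

lemma tendsto_ltree_iff:
  fixes t :: "nat \<Rightarrow> ltree"
  shows "t \<longlonglongrightarrow> l \<longleftrightarrow> (\<forall>h\<ge>1. \<forall>\<^sub>F n in sequentially. ball_eq h (t n) l)"
proof
  assume L: "t \<longlonglongrightarrow> l"
  show "\<forall>h\<ge>1. \<forall>\<^sub>F n in sequentially. ball_eq h (t n) l"
  proof (intro allI impI)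
    fix h :: nat assume "h \<ge> 1"
    then have "open {s. ball_eq h s l}"
      unfolding open_ltree_def by (intro generate_topology.Basis) blast
    then show "\<forall>\<^sub>F n in sequentially. ball_eq h (t n) l"
      using topological_tendstoD[OF L] ball_eq_refl by fastforce
  qed
next
  assume R: "\<forall>h\<ge>1. \<forall>\<^sub>F n in sequentially. ball_eq h (t n) l"
  show "t \<longlonglongrightarrow> l"
  proof (rule topological_tendstoI)
    fix U :: "ltree set" assume "open U" "l \<in> U"
    then have "generate_topology {{s. ball_eq h s t} | h t. h \<ge> 1} U" by (simp add: open_ltree_def)
    then show "\<forall>\<^sub>F n in sequentially. t n \<in> U" using \<open>l \<in> U\<close>
    proof induction
      case (Int a b)
      then show ?case by (auto intro: eventually_conj)
    next
      case (UN K)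
      then obtain k where "k \<in> K" "l \<in> k" by blast
      then show ?case using UN(2)[of k] by (auto elim: eventually_mono)
    next
      case (Basis S)
      then obtain h u where S: "S = {s. ball_eq h s u}" "h \<ge> 1" by blast
      then have "ball_eq h l u" using Basis by blast
      then show ?case
        using R S(2) ball_eq_trans unfolding S(1) by (auto elim!: allE[of _ h] eventually_mono)
    qed simp
  qed
qed

definition walk :: "(nat \<Rightarrow> int) \<Rightarrow> nat \<Rightarrow> int" where
  "walk x n = 1 + (\<Sum>i=1..n. x i)"

definition \<tau> :: "(nat \<Rightarrow> int) \<Rightarrow> enat" where
  "\<tau> x = Inf {enat n | n. n \<ge> 1 \<and> walk x n = 0}"

definition active :: "lgraph \<Rightarrow> nat set" where
  "active t = {v \<in> verts t. vlabel t v = Active}"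

definition freeze :: "nat \<Rightarrow> nat \<Rightarrow> lgraph \<Rightarrow> lgraph" where
  "freeze n v t = t\<lparr>vlabel := (vlabel t)(v := Frozen n)\<rparr>"

text \<open>The vertex created at time \<open>n\<close> is called \<open>n\<close>; this name is new, the root being \<open>0\<close>.\<close>

definition attach :: "nat \<Rightarrow> nat \<Rightarrow> lgraph \<Rightarrow> lgraph" where
  "attach n v t = t\<lparr>verts := insert n (verts t), edges := insert {v, n} (edges t),
     vlabel := (vlabel t)(n := Active), elabel := (elabel t)({v, n} := n)\<rparr>"

text \<open>The tree at time \<open>n\<close> when the vertex chosen at each time \<open>i \<ge> 1\<close> is \<open>v i\<close>.
  If there is no active vertex, then \<open>v (Suc n)\<close> is not active and the tree does not change.\<close>

fun uaf :: "(nat \<Rightarrow> int) \<Rightarrow> (nat \<Rightarrow> nat) \<Rightarrow> nat \<Rightarrow> lgraph" where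
  "uaf x v 0 = single_vertex"
| "uaf x v (Suc n) = (let t = uaf x v n in
     if v (Suc n) \<notin> active t then t
     else if x (Suc n) = - 1 then freeze (Suc n) (v (Suc n)) t
     else attach (Suc n) (v (Suc n)) t)"

lemma is_path_rev: "is_path t p u v \<Longrightarrow> is_path t (rev p) v u"
  by (auto simp: is_path_def hd_rev last_rev insert_commute)

lemma locally_finite_tree_attach:
  assumes t: "locally_finite_tree t" and v: "v \<in> verts t" and n: "n \<notin> verts t"
  shows "locally_finite_tree (attach n v t)"
proof -
  let ?t = "attach n v t"
  have vt: "verts ?t = insert n (verts t)" and et: "edges ?t = insert {v, n} (edges t)"
    and rt: "root_of ?t = root_of t"
    by (auto simp: attach_def)
  have ev: "e \<subseteq> verts t" if "e \<in> edges t" for e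
    using t that by (force simp: locally_finite_tree_def)
  have nb: "a = v" if "{a, n} \<in> edges ?t" "a \<noteq> n" for a
    using that ev[of "{a, n}"] n by (auto simp: et doubleton_eq_iff)
  have up: "is_path ?t p u w" if "is_path t p u w" for p u w
    using that by (auto simp: is_path_def vt et elim!: successively_mono)
  have down: "is_path t p u w" if p: "is_path ?t p u w" and "n \<notin> set p" for p u w
  proof -
    have "successively (\<lambda>a b. {a, b} \<in> edges t) p"
      by (rule successively_mono[where P = "\<lambda>a b. {a, b} \<in> edges ?t"])
        (use that in \<open>auto simp: is_path_def et doubleton_eq_iff\<close>)
    then show ?thesis using that by (auto simp: is_path_def vt)
  qed
  have split: "n \<notin> set p \<or> p = [n] \<or> (\<exists>q. p = q @ [n] \<and> is_path t q u v) \<or> hd p = n"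
    if p: "is_path ?t p u w" for p u w
  proof (cases "n \<in> set p")
    case True
    then obtain a b where ab: "p = a @ n # b" by (meson split_list)
    have dis: "distinct (a @ n # b)" and sub: "set a \<subseteq> verts ?t" "set b \<subseteq> verts ?t"
      and suc: "successively (\<lambda>a b. {a, b} \<in> edges ?t) (a @ n # b)"
      using p by (auto simp: is_path_def ab)
    have la: "last a = v" if "a \<noteq> []"
    proof (rule nb)
      show "{last a, n} \<in> edges ?t" using that suc by (auto simp: successively_append_iff)
      show "last a \<noteq> n" using dis last_in_set[OF that] 
        by (metis distinct_append disjoint_iff list.set_intros(1))
    qed
    have hb: "hd b = v" if "b \<noteq> []"
      using that suc dis hd_in_set[OF that] nb[of "hd b"]
      by (cases b) (auto simp: successively_append_iff insert_commute)
    have "a = [] \<or> b = []"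
      using la hb dis last_in_set[of a] hd_in_set[of b] by auto
    moreover have "is_path t a u v" if "a \<noteq> []" "b = []"
      by (rule down) (use that p dis suc la in \<open>auto simp: is_path_def ab successively_append_iff\<close>)
    ultimately show ?thesis using ab by auto
  qed simp
  have ex1: "\<exists>!p. is_path t p u w" if "u \<in> verts t" "w \<in> verts t" for u w
    using t that by (auto simp: locally_finite_tree_def)
  have old: "\<exists>!p. is_path ?t p u w" if uw: "u \<in> verts t" "w \<in> verts t" for u w
  proof -
    have "n \<notin> set p" if p: "is_path ?t p u w" for p
      using split[OF p] p uw n unfolding is_path_def by (metis last.simps last_snoc list.sel(1))
    then have "is_path ?t p u w \<longleftrightarrow> is_path t p u w" for p using up down by blast
    then show ?thesis using ex1[OF uw] by simp
  qed
  have new: "\<exists>!p. is_path ?t p u n" if u: "u \<in> verts t" for u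
  proof -
    obtain q where q: "is_path t q u v" "\<And>q'. is_path t q' u v \<Longrightarrow> q' = q"
      using ex1[OF u v] by blast
    have "is_path ?t (q @ [n]) u n"
      using q(1) up[OF q(1)] n by (auto simp: is_path_def successively_append_iff et vt)
    moreover have "p = q @ [n]" if p: "is_path ?t p u n" for p
    proof -
      have "hd p \<noteq> n" "n \<in> set p"
        using p u n last_in_set[of p] unfolding is_path_def by auto
      moreover from this have "p \<noteq> [n]" by auto
      ultimately
      obtain q' where "p = q' @ [n]" "is_path t q' u v" using split[OF p] by blast
      then show ?thesis using q(2) by simp
    qed
    ultimately show ?thesis by blast
  qed
  have new': "\<exists>!p. is_path ?t p n u" if u: "u \<in> verts t" for u
    using new[OF u] is_path_rev by (metis rev_rev_ident)
  have nn: "\<exists>!p. is_path ?t p n n"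
  proof (rule ex1I[of _ "[n]"])
    show "is_path ?t [n] n n" by (simp add: is_path_def vt)
    fix p assume "is_path ?t p n n"
    then show "p = [n]" by (cases p) (auto simp: is_path_def split: if_splits)
  qed
  have fin: "finite {w. {u, w} \<in> edges ?t}" if "u \<in> insert n (verts t)" for u
  proof (cases "u = n")
    case True
    then have "{w. {u, w} \<in> edges ?t} \<subseteq> {v, n}" using nb by (auto simp: insert_commute)
    then show ?thesis by (rule finite_subset) simp
  next
    case False
    then have "{w. {u, w} \<in> edges ?t} \<subseteq> insert n (insert v {w. {u, w} \<in> edges t})"
      by (auto simp: et doubleton_eq_iff)
    moreover have "finite {w. {u, w} \<in> edges t}"
      using t that False by (auto simp: locally_finite_tree_def)
    ultimately show ?thesis by (meson finite_insert finite_subset)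
  qed
  have wf: "\<forall>e\<in>edges ?t. \<exists>u\<in>verts ?t. \<exists>w\<in>verts ?t. u \<noteq> w \<and> e = {u, w}"
  proof
    fix e assume "e \<in> edges ?t"
    then consider "e = {v, n}" | "e \<in> edges t" by (auto simp: et)
    then show "\<exists>u\<in>verts ?t. \<exists>w\<in>verts ?t. u \<noteq> w \<and> e = {u, w}"
    proof cases
      case 1
      then show ?thesis using v n by (auto simp: vt)
    next
      case 2
      then obtain u w where "u \<in> verts t" "w \<in> verts t" "u \<noteq> w" "e = {u, w}"
        using t by (auto simp: locally_finite_tree_def)
      then show ?thesis by (auto simp: vt)
    qed
  qed
  have "root_of ?t \<in> verts ?t" using t by (simp add: rt vt locally_finite_tree_def)
  moreover have "\<forall>u\<in>verts ?t. \<forall>w\<in>verts ?t. \<exists>!p. is_path ?t p u w"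
    using old new new' nn by (simp add: vt)
  ultimately show ?thesis
    using wf fin by (simp add: locally_finite_tree_def vt)
qed

lemma locally_finite_tree_freeze:
  "locally_finite_tree (freeze n v t) \<longleftrightarrow> locally_finite_tree t"
  by (simp add: locally_finite_tree_def freeze_def is_path_def)

lemma locally_finite_tree_uaf:
  "locally_finite_tree (uaf x v n) \<and> verts (uaf x v n) \<subseteq> {..n}"
proof (induction n)
  case 0
  then show ?case by (simp add: single_vertex_tree) (simp add: single_vertex_def)
next
  case (Suc n)
  then have "Suc n \<notin> verts (uaf x v n)" by auto
  with Suc show ?case
    by (auto simp: Let_def locally_finite_tree_freeze active_def
        intro!: locally_finite_tree_attach) (auto simp: attach_def freeze_def)
qed

text \<open>As long as there are active vertices, conditionally on the previous choices the next
  vertex is uniform among them.\<close>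

definition uniform_choices :: "'w measure \<Rightarrow> (nat \<Rightarrow> int) \<Rightarrow> (nat \<Rightarrow> 'w \<Rightarrow> nat) \<Rightarrow> bool" where
  "uniform_choices M x V \<longleftrightarrow> (\<forall>i\<ge>1. V i \<in> M \<rightarrow>\<^sub>M count_space UNIV) \<and>
     (\<forall>n v. active (uaf x v n) \<noteq> {} \<longrightarrow> \<P>(\<omega> in M. \<forall>i\<in>{1..n}. V i \<omega> = v i) > 0 \<longrightarrow>
       (\<forall>u. \<P>(\<omega> in M. V (Suc n) \<omega> = u \<bar> \<forall>i\<in>{1..n}. V i \<omega> = v i) =
         pmf (pmf_of_set (active (uaf x v n))) u))"

lemma uaf_cong:
  "(\<And>i. 1 \<le> i \<Longrightarrow> i \<le> n \<Longrightarrow> v i = w i) \<Longrightarrow> uaf x v n = uaf x w n"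
  by (induction n) (simp_all add: Let_def)

text \<open>The process exists: take independent choices indexed by the possible histories.\<close>

lemma uniform_choices_exist:
  "\<exists>(M :: (nat list \<Rightarrow> nat) measure) V. prob_space M \<and> uniform_choices M x V"
proof -
  define A where "A h = active (uaf x (\<lambda>i. h ! (i - 1)) (length h))" for h
  define P where "P h = (if A h = {} then return_pmf 0 else pmf_of_set (A h))" for h
  define M where "M = PiM (UNIV :: nat list set) (\<lambda>h. measure_pmf (P h))"
  define H where "H \<omega> n = rec_nat [] (\<lambda>_ h. h @ [\<omega> h]) n" for \<omega> :: "nat list \<Rightarrow> nat" and n
  define V where "V n \<omega> = \<omega> (H \<omega> (n - 1))" for n \<omega>
  define hist where "hist v n = map v [1..<Suc n]" for v :: "nat \<Rightarrow> nat" and n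
  have H: "H \<omega> 0 = []" "H \<omega> (Suc n) = H \<omega> n @ [\<omega> (H \<omega> n)]" for \<omega> n
    by (simp_all add: H_def)
  interpret product_prob_space "\<lambda>h. measure_pmf (P h)" UNIV
    by (unfold_locales)
  have space: "space M = UNIV" by (simp add: M_def space_PiM)
  have len: "length (hist v n) = n" for v n by (simp add: hist_def)
  have past: "(\<forall>i\<in>{1..n}. V i \<omega> = v i) \<longleftrightarrow> (\<forall>h\<in>hist v ` {..<n}. \<omega> h \<in> {v (Suc (length h))})"
    "(\<forall>i\<in>{1..n}. V i \<omega> = v i) \<Longrightarrow> H \<omega> n = hist v n" for v n \<omega>
  proof (induction n)
    case (Suc n)
    have e: "(\<forall>i\<in>{1..Suc n}. V i \<omega> = v i) \<longleftrightarrow> (\<forall>i\<in>{1..n}. V i \<omega> = v i) \<and> V (Suc n) \<omega> = v (Suc n)"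
      by (auto simp: le_Suc_eq)
    { case 1 show ?case using Suc unfolding e by (auto simp: lessThan_Suc V_def len) }
    { case 2 then show ?case using Suc unfolding e by (auto simp: V_def H hist_def) }
  qed (simp_all add: H hist_def)
  have inj: "inj (hist v)" for v
    by (rule injI) (metis diff_Suc_1 hist_def length_map length_upt)
  have prob: "\<P>(\<omega> in M. \<forall>i\<in>{1..n}. V i \<omega> = v i) = (\<Prod>m<n. pmf (P (hist v m)) (v (Suc m)))" for v n
  proof -
    have "\<P>(\<omega> in M. \<forall>i\<in>{1..n}. V i \<omega> = v i)
        = (\<Prod>h\<in>hist v ` {..<n}. measure (P h) {v (Suc (length h))})"
      unfolding past M_def
      by (subst measure_PiM_emb[symmetric])
        (auto intro!: arg_cong2[of _ _ _ _ measure] simp: prod_emb_def space_PiM PiE_iff)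
    also have "\<dots> = (\<Prod>m<n. pmf (P (hist v m)) (v (Suc m)))"
      using inj_on_subset[OF inj] by (subst prod.reindex) (auto simp: len measure_pmf_single)
    finally show ?thesis .
  qed
  have comp: "(\<lambda>\<omega>. \<omega> h) \<in> M \<rightarrow>\<^sub>M count_space UNIV" for h
  proof -
    have "(\<lambda>\<omega>. \<omega> h) \<in> M \<rightarrow>\<^sub>M measure_pmf (P h)"
      unfolding M_def by (rule measurable_component_singleton) simp
    then show ?thesis by (simp only: measurable_cong_sets[OF refl sets_measure_pmf_count_space])
  qed
  have mH: "(\<lambda>\<omega>. H \<omega> n) \<in> M \<rightarrow>\<^sub>M count_space UNIV" for n
  proof (induction n)
    case (Suc n)
    have "(\<lambda>\<omega>. h @ [\<omega> h]) \<in> M \<rightarrow>\<^sub>M count_space UNIV" for h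
      by (rule measurable_compose[OF comp]) simp
    from measurable_compose_countable[OF this Suc] show ?case by (simp add: H)
  qed (simp add: H)
  have mV: "V n \<in> M \<rightarrow>\<^sub>M count_space UNIV" for n
    using measurable_compose_countable[OF comp mH[of "n - 1"]] by (simp add: V_def[abs_def])
  have "\<P>(\<omega> in M. V (Suc n) \<omega> = u \<bar> \<forall>i\<in>{1..n}. V i \<omega> = v i) = pmf (pmf_of_set (active (uaf x v n))) u"
    if ne: "active (uaf x v n) \<noteq> {}" and pos: "\<P>(\<omega> in M. \<forall>i\<in>{1..n}. V i \<omega> = v i) > 0" for n v u
  proof -
    let ?w = "v(Suc n := u)"
    have hw: "hist ?w m = hist v m" if "m \<le> n" for m using that by (auto simp: hist_def)
    have "(V (Suc n) \<omega> = u \<and> (\<forall>i\<in>{1..n}. V i \<omega> = v i)) \<longleftrightarrow> (\<forall>i\<in>{1..Suc n}. V i \<omega> = ?w i)" for \<omega>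
      by (auto simp: le_Suc_eq)
    then have "\<P>(\<omega> in M. V (Suc n) \<omega> = u \<and> (\<forall>i\<in>{1..n}. V i \<omega> = v i))
      = (\<Prod>m<Suc n. pmf (P (hist ?w m)) (?w (Suc m)))"
      by (simp only: prob)
    also have "\<dots> = (\<Prod>m<Suc n. pmf (P (hist v m)) (?w (Suc m)))"
      by (intro prod.cong refl) (simp only: hw lessThan_iff less_Suc_eq_le)
    also have "\<dots> = (\<Prod>m<n. pmf (P (hist v m)) (v (Suc m))) * pmf (P (hist v n)) u"
      by simp
    finally have "\<P>(\<omega> in M. V (Suc n) \<omega> = u \<and> (\<forall>i\<in>{1..n}. V i \<omega> = v i))
      = \<P>(\<omega> in M. \<forall>i\<in>{1..n}. V i \<omega> = v i) * pmf (P (hist v n)) u"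
      by (simp only: prob)
    then have "\<P>(\<omega> in M. V (Suc n) \<omega> = u \<bar> \<forall>i\<in>{1..n}. V i \<omega> = v i) = pmf (P (hist v n)) u"
      unfolding cond_prob_def using nonzero_mult_div_cancel_left[OF less_imp_neq[OF pos, symmetric]]
      by (simp only:)
    moreover have "A (hist v n) = active (uaf x v n)"
    proof -
      have "uaf x (\<lambda>i. hist v n ! (i - 1)) n = uaf x v n"
        by (rule uaf_cong) (simp add: hist_def del: upt_Suc)
      then show ?thesis by (simp only: A_def len)
    qed
    ultimately show ?thesis using ne by (simp add: P_def)
  qed
  then have "uniform_choices M x V" using mV by (simp add: uniform_choices_def)
  moreover have "prob_space M" unfolding M_def by (rule prob_space_PiM) (rule prob_space_measure_pmf)
  ultimately show ?thesis by blast
qed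

definition uaf_tree :: "(nat \<Rightarrow> int) \<Rightarrow> (nat \<Rightarrow> 'w \<Rightarrow> nat) \<Rightarrow> nat \<Rightarrow> 'w \<Rightarrow> ltree" where
  "uaf_tree x V n \<omega> = abs_ltree (uaf x (\<lambda>i. V i \<omega>) n)"

lemma measurable_uaf_tree:
  assumes "uniform_choices M x V"
  shows "uaf_tree y V n \<in> borel_measurable M"
proof -
  define L where "L n \<omega> = map (\<lambda>i. V i \<omega>) [1..<Suc n]" for n \<omega>
  have L: "L 0 = (\<lambda>_. [])" "L (Suc n) = (\<lambda>\<omega>. L n \<omega> @ [V (Suc n) \<omega>])" for n
    by (simp_all add: L_def[abs_def])
  have V: "V (Suc i) \<in> M \<rightarrow>\<^sub>M count_space UNIV" for i
    using assms by (simp add: uniform_choices_def)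
  have "L n \<in> M \<rightarrow>\<^sub>M count_space UNIV" for n
  proof (induction n)
    case (Suc n)
    have "(\<lambda>\<omega>. h @ [V (Suc n) \<omega>]) \<in> M \<rightarrow>\<^sub>M count_space UNIV" for h
      by (rule measurable_compose[OF V]) simp
    from measurable_compose_countable[OF this Suc] show ?case by (simp add: L)
  qed (simp add: L)
  moreover have "uaf_tree y V n = (\<lambda>\<omega>. abs_ltree (uaf y (\<lambda>i. L n \<omega> ! (i - 1)) n))"
  proof
    fix \<omega>
    have "uaf y (\<lambda>i. V i \<omega>) n = uaf y (\<lambda>i. L n \<omega> ! (i - 1)) n"
    proof (rule uaf_cong)
      fix i assume i: "1 \<le> i" "i \<le> n"
      then have "[1..<Suc n] ! (i - 1) = i" by (subst nth_upt) auto
      then show "V i \<omega> = L n \<omega> ! (i - 1)" using i by (simp add: L_def del: upt_Suc)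
    qed
    then show "uaf_tree y V n \<omega> = abs_ltree (uaf y (\<lambda>i. L n \<omega> ! (i - 1)) n)"
      by (simp add: uaf_tree_def)
  qed
  ultimately show ?thesis by (auto intro: measurable_compose)
qed

definition converges_weakly :: "(nat \<Rightarrow> 'a::topological_space measure) \<Rightarrow> 'a measure \<Rightarrow> bool" where
  "converges_weakly \<mu> \<nu> \<longleftrightarrow>
     (\<forall>f::'a \<Rightarrow> real. continuous_on UNIV f \<and> bounded (range f) \<longrightarrow>
       (\<lambda>n. LINT y|\<mu> n. f y) \<longlonglongrightarrow> (LINT y|\<nu>. f y))"

end

theory Submission
  imports Defs
begin

text \<open>At time \<open>n + 1\<close> each of the \<open>walk x n\<close> active vertices is chosen with the same probability, so
  a given active vertex is frozen with probability \<open>freeze_rate x n\<close>. As the walk never reaches zero,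
  these rates are less than one, and their series converges together with the series of the theorem.

  If the series diverges, then almost surely every vertex is eventually frozen (\<open>AE_settles\<close>). A frozen
  vertex receives no further edges, so the union of the trees is locally finite, and each of its balls
  is, from some time on, a ball of the current tree in which all vertices are frozen. Such a ball
  cannot change any more, whatever the driving sequence and the choices do later (\<open>ball_stable\<close>). This
  gives the almost sure limit. It also gives the limit in distribution: up to a fixed time \<open>m\<close> the \<open>n\<close>-th
  process has the law of the limiting one once \<open>n\<close> is large, and what happens after \<open>m\<close> affects a given
  bounded continuous function only with small probability (\<open>weak_limit\<close>).

  If the series converges, then the root remains active forever with positive probability. While it
  is active it is chosen infinitely often, because \<open>walk x n \<le> n + 1\<close> and the harmonic series diverges;
  so it has arbitrarily many children with a probability bounded below (\<open>root_degree_not_tight\<close>).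
  As the degree of the root is a continuous function of the tree, this rules out a limit in
  distribution (\<open>weak_limit_not_summable\<close>), and hence also an almost sure limit.\<close>

section \<open>Growth of trees and stabilization of balls\<close>

text \<open>What an instance of the growth process may do to a tree: add vertices and edges and freeze active
  vertices, while a frozen vertex keeps its label and receives no further edge. The target may be
  infinite, so that the limit tree is an extension of every finite stage as well.\<close>

definition extends :: "lgraph \<Rightarrow> lgraph \<Rightarrow> bool" where
  "extends s t \<longleftrightarrow> verts s \<subseteq> verts t \<and> root_of t = root_of s \<and> edges s \<subseteq> edges t \<and>
     (\<forall>e\<in>edges s. elabel t e = elabel s e) \<and>
     (\<forall>u\<in>verts s. vlabel s u \<noteq> Active \<longrightarrow>
        vlabel t u = vlabel s u \<and> (\<forall>e\<in>edges t. u \<in> e \<longrightarrow> e \<in> edges s))"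

lemma extends_refl: "extends t t"
  by (simp add: extends_def)

lemma extends_trans: "extends s t \<Longrightarrow> extends t u \<Longrightarrow> extends s u"
  unfolding extends_def by (smt (verit) subset_iff)

lemma edge_subset_verts: "locally_finite_tree t \<Longrightarrow> e \<in> edges t \<Longrightarrow> e \<subseteq> verts t"
  by (force simp: locally_finite_tree_def)

lemma is_path_mono:
  "is_path s p u w \<Longrightarrow> verts s \<subseteq> verts t \<Longrightarrow> edges s \<subseteq> edges t \<Longrightarrow> is_path t p u w"
  by (auto simp: is_path_def elim!: successively_mono)

lemma depth_le_path: "is_path t p (root_of t) v \<Longrightarrow> length p \<le> Suc k \<Longrightarrow> depth t v \<le> k"
proof -
  assume p: "is_path t p (root_of t) v" and l: "length p \<le> Suc k"
  have "p \<noteq> []" using p by (simp add: is_path_def)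
  then have "length p = Suc (length p - 1)" by (cases p) auto
  then have "depth t v \<le> length p - 1" unfolding depth_def using p by (intro Least_le) blast
  then show ?thesis using l by simp
qed

lemma tree_path_to:
  assumes t: "locally_finite_tree t" and v: "v \<in> verts t"
  obtains p where "is_path t p (root_of t) v" "length p = Suc (depth t v)"
proof -
  have r: "root_of t \<in> verts t" using t by (simp add: locally_finite_tree_def)
  obtain q where q: "is_path t q (root_of t) v"
    using t r v unfolding locally_finite_tree_def by (metis (no_types))
  have "q \<noteq> []" using q by (simp add: is_path_def)
  then have "length q = Suc (length q - 1)" by (cases q) auto
  then have "\<exists>p. is_path t p (root_of t) v \<and> length p = Suc (depth t v)"
    unfolding depth_def using q
    by (intro LeastI[of "\<lambda>k. \<exists>p. is_path t p (root_of t) v \<and> length p = Suc k"]) blast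
  then show thesis using that by blast
qed

lemma depth_extends_le:
  assumes s: "locally_finite_tree s" and e: "extends s t" and u: "u \<in> verts s"
  shows "depth t u \<le> depth s u"
proof -
  obtain p where p: "is_path s p (root_of s) u" "length p = Suc (depth s u)"
    using tree_path_to[OF s u] .
  have "is_path t p (root_of t) u"
    using is_path_mono[OF p(1)] e by (simp add: extends_def)
  then show ?thesis using p(2) by (intro depth_le_path) auto
qed

lemma is_path_snoc:
  "is_path t p u w \<Longrightarrow> {w, z} \<in> edges t \<Longrightarrow> z \<in> verts t \<Longrightarrow> z \<notin> set p \<Longrightarrow> is_path t (p @ [z]) u z"
  by (auto simp: is_path_def successively_append_iff)

lemma is_path_butlast:
  assumes "is_path t (p @ [z]) u z'" "p \<noteq> []"
  shows "is_path t p u (last p)" "{last p, z} \<in> edges t" "z' = z" "z \<in> verts t" "z \<notin> set p"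
  using assms by (auto simp: is_path_def successively_append_iff)

text \<open>A path that starts at the root and has at most \<open>h\<close> edges leaves only vertices of the ball of
  radius \<open>h\<close>. These are frozen, so every edge it uses was there before the extension.\<close>

lemma path_in_frozen_ball:
  assumes fr: "\<And>u. u \<in> verts s \<Longrightarrow> depth s u \<le> h \<Longrightarrow> vlabel s u \<noteq> Active"
    and s: "locally_finite_tree s" and e: "extends s t"
  shows "is_path t p (root_of s) v \<Longrightarrow> length p \<le> Suc (Suc h) \<Longrightarrow> is_path s p (root_of s) v"
proof (induction p arbitrary: v rule: rev_induct)
  case Nil
  then show ?case by (simp add: is_path_def)
next
  case (snoc z p)
  show ?case
  proof (cases "p = []")
    case True
    then show ?thesis using snoc.prems s by (auto simp: is_path_def locally_finite_tree_def)
  next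
    case False
    note b = is_path_butlast[OF snoc.prems(1) False]
    have ps: "is_path s p (root_of s) (last p)" using snoc.IH[OF b(1)] snoc.prems(2) by simp
    then have l: "last p \<in> verts s" using False by (auto simp: is_path_def)
    have "depth s (last p) \<le> h" using depth_le_path[OF ps] snoc.prems(2) by simp
    then have "vlabel s (last p) \<noteq> Active" using fr l by blast
    then have ed: "{last p, z} \<in> edges s" using e l b(2) unfolding extends_def by blast
    moreover have "z \<in> verts s" using edge_subset_verts[OF s ed] by simp
    ultimately show ?thesis using is_path_snoc[OF ps] b(3,5) by simp
  qed
qed

text \<open>Active vertices are the only places where growth happens. A ball without active vertices is
  therefore the same in every extension, under the identity map.\<close>

lemma ball_stable:
  assumes fr: "\<And>u. u \<in> verts s \<Longrightarrow> depth s u \<le> h \<Longrightarrow> vlabel s u \<noteq> Active"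
    and s: "locally_finite_tree s" and t: "locally_finite_tree t" and e: "extends s t"
  shows "isomorphic (ball_of h s) (ball_of h t)"
proof -
  have rt: "root_of t = root_of s" using e by (simp add: extends_def)
  have up: "u \<in> verts s \<and> depth s u \<le> h" if u: "u \<in> verts t" "depth t u \<le> h" for u
  proof -
    obtain p where p: "is_path t p (root_of t) u" "length p = Suc (depth t u)"
      using tree_path_to[OF t u(1)] .
    have ps: "is_path s p (root_of s) u"
      using path_in_frozen_ball[OF fr s e] p u(2) by (simp add: rt)
    then have "depth s u \<le> h" using depth_le_path[OF ps] p(2) u(2) by simp
    moreover have "u \<in> verts s" using ps by (auto simp: is_path_def)
    ultimately show ?thesis by blast
  qed
  have dn: "u \<in> verts t \<and> depth t u \<le> h" if "u \<in> verts s" "depth s u \<le> h" for u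
    using depth_extends_le[OF s e that(1)] that e by (auto simp: extends_def)
  have V: "{v \<in> verts t. depth t v \<le> h} = {v \<in> verts s. depth s v \<le> h}" using up dn by blast
  have "is_iso (\<lambda>u. u) (ball_of h s) (ball_of h t)"
    unfolding is_iso_def ball_of_def Let_def V
    using e rt fr unfolding extends_def by (auto simp: bij_betw_def)
  then show ?thesis by (auto simp: isomorphic_def)
qed

text \<open>Level by level: a vertex of the next level is a neighbour of one of the finitely many before.\<close>

lemma finite_ball:
  assumes t: "locally_finite_tree t"
  shows "finite {v \<in> verts t. depth t v \<le> h}"
proof (induction h)
  case 0
  have "v = root_of t" if v: "v \<in> verts t" "depth t v \<le> 0" for v
  proof -
    obtain p where "is_path t p (root_of t) v" "length p = Suc (depth t v)"
      using tree_path_to[OF t v(1)] .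
    then show ?thesis using v(2) by (cases p) (auto simp: is_path_def)
  qed
  then show ?case by (auto intro: finite_subset[of _ "{root_of t}"])
next
  case (Suc h)
  let ?B = "{v \<in> verts t. depth t v \<le> h}"
  have "v \<in> ?B \<union> (\<Union>u\<in>?B. {w. {u, w} \<in> edges t})" if v: "v \<in> verts t" "depth t v \<le> Suc h" for v
  proof (cases "depth t v \<le> h")
    case False
    obtain p where p: "is_path t p (root_of t) v" "length p = Suc (depth t v)"
      using tree_path_to[OF t v(1)] .
    then obtain q z where q: "p = q @ [z]" by (cases p rule: rev_cases) auto
    have "q \<noteq> []" using p False by (auto simp: q)
    note b = is_path_butlast[OF p(1)[unfolded q] this]
    have "last q \<in> verts t" using b(1) \<open>q \<noteq> []\<close> by (auto simp: is_path_def)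
    moreover have "depth t (last q) \<le> h" using depth_le_path[OF b(1)] p(2) v(2) by (simp add: q)
    ultimately show ?thesis using b(2,3) by blast
  qed (use v in blast)
  moreover have "finite (?B \<union> (\<Union>u\<in>?B. {w. {u, w} \<in> edges t}))"
    using Suc t by (auto simp: locally_finite_tree_def)
  ultimately show ?case by (blast intro: finite_subset)
qed

section \<open>The tree process as a growth process\<close>

lemma tree_uaf: "locally_finite_tree (uaf x v n)"
  using locally_finite_tree_uaf by blast

lemma verts_uaf: "u \<in> verts (uaf x v n) \<Longrightarrow> u \<le> n"
  using locally_finite_tree_uaf[of x v n] by auto

lemma root_uaf: "root_of (uaf x v n) = 0"
  by (induction n) (simp_all add: Let_def freeze_def attach_def, simp add: single_vertex_def)

lemma root_in_uaf: "0 \<in> verts (uaf x v n)"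
  using tree_uaf[of x v n] by (simp add: locally_finite_tree_def root_uaf)

lemma uaf_prefix_cong:
  assumes "\<And>i. 1 \<le> i \<Longrightarrow> i \<le> n \<Longrightarrow> v i = w i" "\<And>i. 1 \<le> i \<Longrightarrow> i \<le> n \<Longrightarrow> x i = y i"
  shows "uaf x v n = uaf y w n"
  using assms by (induction n) (simp_all add: Let_def)

lemma extends_freeze: "v \<in> active t \<Longrightarrow> extends t (freeze n v t)"
  by (auto simp: extends_def freeze_def active_def)

lemma extends_attach:
  assumes t: "locally_finite_tree t" and v: "v \<in> active t" and n: "n \<notin> verts t"
  shows "extends t (attach n v t)"
proof -
  have "{v, n} \<notin> edges t" using edge_subset_verts[OF t] n by blast
  then show ?thesis using v n by (auto simp: extends_def attach_def active_def)
qed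

lemma extends_uaf:
  assumes "m \<le> n" "\<And>i. 1 \<le> i \<Longrightarrow> i \<le> m \<Longrightarrow> v i = w i" "\<And>i. 1 \<le> i \<Longrightarrow> i \<le> m \<Longrightarrow> x i = y i"
  shows "extends (uaf x v m) (uaf y w n)"
  using assms(1)
proof (induction n rule: dec_induct)
  case base
  then show ?case using uaf_prefix_cong[of m v w x y] assms by (simp add: extends_refl)
next
  case (step n)
  have "Suc n \<notin> verts (uaf y w n)" using verts_uaf[of "Suc n" y w n] by auto
  then have "extends (uaf y w n) (uaf y w (Suc n))"
    by (auto simp: Let_def extends_refl intro: extends_freeze extends_attach tree_uaf)
  with step.IH show ?case by (rule extends_trans)
qed

lemma finite_active: "finite (active (uaf x v n))"
  by (rule finite_subset[of _ "{..n}"]) (auto simp: active_def dest: verts_uaf)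

lemma active_uaf_Suc:
  "active (uaf x v (Suc n)) = (if v (Suc n) \<notin> active (uaf x v n) then active (uaf x v n)
     else if x (Suc n) = - 1 then active (uaf x v n) - {v (Suc n)}
     else insert (Suc n) (active (uaf x v n)))"
  using verts_uaf[of "Suc n" x v n] by (auto simp: Let_def active_def freeze_def attach_def)

lemma active_antimono:
  assumes "m \<le> n" "j \<le> m" "j \<in> active (uaf x v n)"
  shows "j \<in> active (uaf x v m)"
  using assms
proof (induction n rule: dec_induct)
  case (step n)
  then have "j \<in> active (uaf x v n)" by (auto simp: active_uaf_Suc simp del: uaf.simps split: if_splits)
  then show ?case using step by blast
qed

text \<open>Vertex \<open>j\<close> is born at time \<open>j\<close> or never, and it is trivially inactive before; this is why
  inactivity is only asked for at some time \<open>m \<ge> j\<close>.\<close>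

definition settles :: "(nat \<Rightarrow> int) \<Rightarrow> (nat \<Rightarrow> nat) \<Rightarrow> bool" where
  "settles x v \<longleftrightarrow> (\<forall>j. \<exists>m\<ge>j. j \<notin> active (uaf x v m))"

lemma settles_frozen:
  assumes "settles x v" shows "\<forall>\<^sub>F m in sequentially. j \<notin> active (uaf x v m)"
proof -
  obtain m where "m \<ge> j" "j \<notin> active (uaf x v m)" using assms by (auto simp: settles_def)
  then show ?thesis using active_antimono unfolding eventually_sequentially by blast
qed

section \<open>The limit tree\<close>

text \<open>The labels of a given vertex or edge of the growing trees are eventually constant along the
  process; their final values label the union of the trees.\<close>

definition eventual :: "(nat \<Rightarrow> 'c) \<Rightarrow> 'c" where
  "eventual f = (SOME l. \<forall>\<^sub>F n in sequentially. f n = l)"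

lemma eventual_eq:
  assumes "\<And>n. n \<ge> m \<Longrightarrow> f n = l" shows "eventual f = l"
proof -
  have l: "\<forall>\<^sub>F n in sequentially. f n = l" using assms by (auto simp: eventually_sequentially)
  then have "\<forall>\<^sub>F n in sequentially. f n = eventual f" unfolding eventual_def by (rule someI)
  with l have "\<forall>\<^sub>F n::nat in sequentially. eventual f = l" by eventually_elim simp
  then show ?thesis by simp
qed

definition limit_graph :: "(nat \<Rightarrow> int) \<Rightarrow> (nat \<Rightarrow> nat) \<Rightarrow> lgraph" where
  "limit_graph x v = \<lparr>verts = (\<Union>n. verts (uaf x v n)), root_of = 0,
     edges = (\<Union>n. edges (uaf x v n)), vlabel = (\<lambda>u. eventual (\<lambda>n. vlabel (uaf x v n) u)),
     elabel = (\<lambda>e. eventual (\<lambda>n. elabel (uaf x v n) e))\<rparr>"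

lemma extends_limit_graph: "extends (uaf x v m) (limit_graph x v)"
proof -
  let ?T = "uaf x v" and ?L = "limit_graph x v"
  have e: "extends (?T m) (?T n)" if "n \<ge> m" for n using extends_uaf[OF that] by blast
  have "eventual (\<lambda>n. elabel (?T n) d) = elabel (?T m) d" if "d \<in> edges (?T m)" for d
    by (rule eventual_eq[of m]) (use e that in \<open>unfold extends_def, blast\<close>)
  moreover have "eventual (\<lambda>n. vlabel (?T n) u) = vlabel (?T m) u"
    if "u \<in> verts (?T m)" "vlabel (?T m) u \<noteq> Active" for u
    by (rule eventual_eq[of m]) (use e that in \<open>unfold extends_def, blast\<close>)
  moreover have "d \<in> edges (?T m)"
    if u: "u \<in> verts (?T m)" "vlabel (?T m) u \<noteq> Active" "d \<in> edges ?L" "u \<in> d" for u d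
  proof -
    obtain k where k: "d \<in> edges (?T k)" using u by (auto simp: limit_graph_def)
    have "extends (?T k) (?T (max k m))" by (rule extends_uaf) auto
    then have "d \<in> edges (?T (max k m))" using k by (auto simp: extends_def)
    then show ?thesis using e[of "max k m"] u unfolding extends_def by auto
  qed
  ultimately show ?thesis
    unfolding extends_def by (auto simp: limit_graph_def root_uaf)
qed

text \<open>A union of growing trees is a tree because every path is finite and lies in one of them. Local
  finiteness is where settling matters: a vertex that is frozen at some time has then all the
  edges that it will ever have.\<close>

lemma tree_limit_graph:
  assumes "settles x v"
  shows "locally_finite_tree (limit_graph x v)"
proof -
  let ?T = "uaf x v" and ?L = "limit_graph x v"
  have vs: "verts ?L = (\<Union>n. verts (?T n))" and es: "edges ?L = (\<Union>n. edges (?T n))"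
    and rt: "root_of ?L = 0" by (auto simp: limit_graph_def)
  have mono: "verts (?T m) \<subseteq> verts (?T n)" "edges (?T m) \<subseteq> edges (?T n)" if "m \<le> n" for m n
    using extends_uaf[OF that, of v v x x] by (auto simp: extends_def)
  have vev: "\<forall>\<^sub>F n in sequentially. u \<in> verts (?T n)" if "u \<in> verts ?L" for u
    using that mono(1) unfolding vs eventually_sequentially by blast
  have eev: "\<forall>\<^sub>F n in sequentially. e \<in> edges (?T n)" if "e \<in> edges ?L" for e
    using that mono(2) unfolding es eventually_sequentially by blast
  have pev: "\<forall>\<^sub>F n in sequentially. is_path (?T n) p u w" if "is_path ?L p u w" for p u w
  proof -
    have "\<forall>\<^sub>F n in sequentially. \<forall>z\<in>set p. z \<in> verts (?T n)"
      by (rule eventually_ball_finite) (use that vev in \<open>auto simp: is_path_def\<close>)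
    moreover have "\<forall>\<^sub>F n in sequentially. \<forall>e\<in>{{a, b} |a b. a \<in> set p \<and> b \<in> set p} \<inter> edges ?L. e \<in> edges (?T n)"
      by (rule eventually_ball_finite)
        (use eev in \<open>auto intro: finite_subset[of _ "Pow (set p)"]\<close>)
    ultimately show ?thesis
    proof eventually_elim
      case (elim n)
      have "successively (\<lambda>a b. {a, b} \<in> edges (?T n)) p"
        by (rule successively_mono[where P = "\<lambda>a b. {a, b} \<in> edges ?L"])
          (use that elim in \<open>auto simp: is_path_def\<close>)
      then show ?case using that elim by (auto simp: is_path_def)
    qed
  qed
  have paths: "\<exists>!p. is_path ?L p u w" if uw: "u \<in> verts ?L" "w \<in> verts ?L" for u w
  proof -
    have "\<forall>\<^sub>F n in sequentially. u \<in> verts (?T n) \<and> w \<in> verts (?T n)"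
      using vev uw by (auto intro: eventually_conj)
    then obtain n where n: "u \<in> verts (?T n)" "w \<in> verts (?T n)"
      by (auto simp: eventually_sequentially)
    then obtain p where "is_path (?T n) p u w"
      using tree_uaf[of x v n] unfolding locally_finite_tree_def by (metis (no_types))
    then have p: "is_path ?L p u w" by (rule is_path_mono) (auto simp: vs es)
    have "q = p" if q: "is_path ?L q u w" for q
    proof -
      have "\<forall>\<^sub>F n in sequentially. is_path (?T n) p u w \<and> is_path (?T n) q u w"
        using pev p q by (auto intro: eventually_conj)
      then obtain k where "is_path (?T k) p u w" "is_path (?T k) q u w"
        by (auto simp: eventually_sequentially)
      moreover from this have "u \<in> verts (?T k)" "w \<in> verts (?T k)" by (auto simp: is_path_def)
      ultimately show ?thesis
        using tree_uaf[of x v k] unfolding locally_finite_tree_def by blast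
    qed
    with p show ?thesis by blast
  qed
  have fin: "finite {w. {u, w} \<in> edges ?L}" if u: "u \<in> verts ?L" for u
  proof -
    have "\<forall>\<^sub>F n in sequentially. u \<in> verts (?T n) \<and> u \<notin> active (?T n)"
      using vev[OF u] settles_frozen[OF assms, of u] by (rule eventually_conj)
    then obtain n where n: "u \<in> verts (?T n)" "vlabel (?T n) u \<noteq> Active"
      by (auto simp: eventually_sequentially active_def)
    then have "{w. {u, w} \<in> edges ?L} \<subseteq> {w. {u, w} \<in> edges (?T n)}"
      using extends_limit_graph[of x v n] unfolding extends_def by blast
    moreover have "finite {w. {u, w} \<in> edges (?T n)}"
      using tree_uaf[of x v n] n by (auto simp: locally_finite_tree_def)
    ultimately show ?thesis by (rule finite_subset)
  qed
  have wf: "\<exists>u\<in>verts ?L. \<exists>w\<in>verts ?L. u \<noteq> w \<and> e = {u, w}" if e: "e \<in> edges ?L" for e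
  proof -
    obtain n where "e \<in> edges (?T n)" using e by (auto simp: es)
    then have "\<exists>u\<in>verts (?T n). \<exists>w\<in>verts (?T n). u \<noteq> w \<and> e = {u, w}"
      using tree_uaf[of x v n] by (auto simp: locally_finite_tree_def)
    then show ?thesis by (auto simp: vs)
  qed
  have "root_of ?L \<in> verts ?L" using root_in_uaf by (auto simp: vs rt)
  then show ?thesis using paths fin wf by (simp add: locally_finite_tree_def)
qed

text \<open>Distances can only decrease in an extension, so the ball at time \<open>m\<close> lies in the ball of
  the limit tree. The latter is finite, hence entirely frozen from some time on.\<close>

lemma ball_freezes:
  assumes S: "settles x v"
  shows "\<forall>\<^sub>F m in sequentially. \<forall>u\<in>verts (uaf x v m). depth (uaf x v m) u \<le> h \<longrightarrow>
    vlabel (uaf x v m) u \<noteq> Active"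
proof -
  let ?L = "limit_graph x v"
  have "\<forall>\<^sub>F m in sequentially. \<forall>u\<in>{u \<in> verts ?L. depth ?L u \<le> h}. u \<notin> active (uaf x v m)"
    by (intro eventually_ball_finite ballI finite_ball tree_limit_graph settles_frozen S)
  then show ?thesis
  proof eventually_elim
    case (elim m)
    have "vlabel (uaf x v m) u \<noteq> Active" if u: "u \<in> verts (uaf x v m)" "depth (uaf x v m) u \<le> h" for u
    proof -
      have "depth ?L u \<le> h"
        using depth_extends_le[OF tree_uaf extends_limit_graph u(1)] u(2) by linarith
      moreover have "u \<in> verts ?L" using u by (auto simp: limit_graph_def)
      ultimately show ?thesis using elim u by (auto simp: active_def)
    qed
    then show ?case by blast
  qed
qed

lemma ball_eq_abs:
  assumes "locally_finite_tree s" "locally_finite_tree t"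
  shows "ball_eq h (abs_ltree s) (abs_ltree t) \<longleftrightarrow> isomorphic (ball_of h s) (ball_of h t)"
  using assms by (simp add: ball_eq.abs_eq isomorphic_refl)

lemma extensions_ball_eq:
  assumes S: "settles x v"
  shows "\<forall>\<^sub>F m in sequentially. \<forall>t. locally_finite_tree t \<and> extends (uaf x v m) t \<longrightarrow>
    ball_eq h (abs_ltree t) (abs_ltree (uaf x v m))"
  using ball_freezes[OF S, of h]
proof eventually_elim
  case (elim m)
  then show ?case
    using ball_stable[of "uaf x v m" h] tree_uaf[of x v m] ball_eq_abs ball_eq_sym by blast
qed

lemma extensions_tendsto:
  assumes S: "settles x v"
    and t: "\<And>m. locally_finite_tree (t m)" "\<And>m. extends (uaf x v m) (t m)"
    and L: "(\<lambda>m. abs_ltree (uaf x v m)) \<longlonglongrightarrow> T"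
  shows "(\<lambda>m. abs_ltree (t m)) \<longlonglongrightarrow> T"
  unfolding tendsto_ltree_iff
proof (intro allI impI)
  fix h :: nat assume h: "h \<ge> 1"
  have "\<forall>\<^sub>F m in sequentially. ball_eq h (abs_ltree (uaf x v m)) T"
    using L h by (simp add: tendsto_ltree_iff)
  with extensions_ball_eq[OF S, of h] show "\<forall>\<^sub>F m in sequentially. ball_eq h (abs_ltree (t m)) T"
    by eventually_elim (use t ball_eq_trans in blast)
qed

lemma uaf_tendsto_limit_graph:
  assumes S: "settles x v"
  shows "(\<lambda>m. abs_ltree (uaf x v m)) \<longlonglongrightarrow> abs_ltree (limit_graph x v)"
  unfolding tendsto_ltree_iff
proof (intro allI impI)
  fix h :: nat
  show "\<forall>\<^sub>F m in sequentially. ball_eq h (abs_ltree (uaf x v m)) (abs_ltree (limit_graph x v))"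
    using extensions_ball_eq[OF S, of h]
    by eventually_elim (use tree_limit_graph[OF S] extends_limit_graph ball_eq_sym in blast)
qed

text \<open>This is how convergence is used below: membership of the limit in an open set can be read off
  from a finite stage, uniformly over everything that may still happen afterwards. If bad extensions
  existed at infinitely many stages, then together with the stages themselves they would form a
  sequence that converges to \<open>T\<close> but leaves \<open>U\<close> infinitely often.\<close>

lemma extensions_in_open:
  assumes S: "settles x v" and L: "(\<lambda>m. abs_ltree (uaf x v m)) \<longlonglongrightarrow> T"
    and U: "open U" "T \<in> U"
  shows "\<forall>\<^sub>F m in sequentially. \<forall>t. locally_finite_tree t \<and> extends (uaf x v m) t \<longrightarrow> abs_ltree t \<in> U"
proof -
  define bad where "bad m t \<longleftrightarrow> locally_finite_tree t \<and> extends (uaf x v m) t \<and> abs_ltree t \<notin> U" for m t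
  define t where "t m = (if \<exists>t. bad m t then SOME t. bad m t else uaf x v m)" for m
  have bt: "bad m (t m)" if "\<exists>s. bad m s" for m using that by (simp add: t_def someI_ex)
  have "locally_finite_tree (t m) \<and> extends (uaf x v m) (t m)" for m
  proof (cases "\<exists>s. bad m s")
    case True
    then show ?thesis using bt by (auto simp: bad_def)
  next
    case False
    then show ?thesis by (simp add: t_def tree_uaf extends_refl)
  qed
  then have "(\<lambda>m. abs_ltree (t m)) \<longlonglongrightarrow> T" by (intro extensions_tendsto[OF S _ _ L]) auto
  then have "\<forall>\<^sub>F m in sequentially. abs_ltree (t m) \<in> U" using U by (rule topological_tendstoD)
  then show ?thesis by eventually_elim (use bt bad_def in blast)
qed

section \<open>The degree of the root\<close>

definition root_deg :: "lgraph \<Rightarrow> nat" where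
  "root_deg t = card {w. {root_of t, w} \<in> edges t}"

lemma finite_root_nbs: "locally_finite_tree t \<Longrightarrow> finite {w. {root_of t, w} \<in> edges t}"
  by (auto simp: locally_finite_tree_def)

lemma root_deg_mono: "locally_finite_tree t \<Longrightarrow> extends s t \<Longrightarrow> root_deg s \<le> root_deg t"
  unfolding root_deg_def by (rule card_mono[OF finite_root_nbs]) (auto simp: extends_def)

lemma isomorphic_root_deg:
  assumes "isomorphic s t" and es: "\<And>e. e \<in> edges s \<Longrightarrow> e \<subseteq> verts s"
    "\<And>e. e \<in> edges t \<Longrightarrow> e \<subseteq> verts t" and r: "root_of s \<in> verts s"
  shows "root_deg s = root_deg t"
proof -
  obtain f where f: "is_iso f s t" using assms by (auto simp: isomorphic_def)
  then have inj: "inj_on f (verts s)" and im: "verts t = f ` verts s"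
    by (auto simp: is_iso_def bij_betw_def)
  have "{root_of t, f w} \<in> edges t \<longleftrightarrow> {root_of s, w} \<in> edges s" if "w \<in> verts s" for w
    using f r that unfolding is_iso_def by metis
  then have "f ` {w \<in> verts s. {root_of s, w} \<in> edges s} = {w \<in> verts t. {root_of t, w} \<in> edges t}"
    unfolding im by blast
  then have "bij_betw f {w \<in> verts s. {root_of s, w} \<in> edges s} {w \<in> verts t. {root_of t, w} \<in> edges t}"
    using inj_on_subset[OF inj] by (simp add: bij_betw_def)
  moreover have "{w \<in> verts s. {root_of s, w} \<in> edges s} = {w. {root_of s, w} \<in> edges s}"
    "{w \<in> verts t. {root_of t, w} \<in> edges t} = {w. {root_of t, w} \<in> edges t}"
    using es by blast+
  ultimately show ?thesis unfolding root_deg_def using bij_betw_same_card by fastforce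
qed

lift_definition root_degree :: "ltree \<Rightarrow> nat" is root_deg
  by (rule isomorphic_root_deg) (auto dest: edge_subset_verts simp: locally_finite_tree_def)

lemma root_degree_abs: "locally_finite_tree t \<Longrightarrow> root_degree (abs_ltree t) = root_deg t"
  by (simp add: root_degree.abs_eq isomorphic_refl)

lemma root_deg_ball:
  assumes t: "locally_finite_tree t"
  shows "root_deg (ball_of 1 t) = root_deg t"
proof -
  have r: "root_of t \<in> verts t" using t by (simp add: locally_finite_tree_def)
  have d: "depth t (root_of t) \<le> 1"
    by (rule depth_le_path[of _ "[root_of t]"]) (use r in \<open>auto simp: is_path_def\<close>)
  have "w \<in> verts t \<and> depth t w \<le> 1" if e: "{root_of t, w} \<in> edges t" for w
  proof -
    have w: "w \<in> verts t" using edge_subset_verts[OF t e] by simp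
    have "root_of t \<noteq> w" using t e unfolding locally_finite_tree_def by (metis doubleton_eq_iff)
    then have "is_path t [root_of t, w] (root_of t) w" using r w e by (auto simp: is_path_def)
    then show ?thesis using depth_le_path w by fastforce
  qed
  then have "{w. {root_of t, w} \<in> edges (ball_of 1 t)} = {w. {root_of t, w} \<in> edges t}"
    using r d by (auto simp: ball_of_def Let_def)
  then show ?thesis by (simp add: root_deg_def ball_of_def Let_def)
qed

lemma ball_eq_root_degree: "ball_eq 1 s t \<Longrightarrow> root_degree s = root_degree t"
proof (transfer, elim conjE)
  fix s t assume st: "locally_finite_tree s" "locally_finite_tree t"
    and i: "isomorphic (ball_of 1 s) (ball_of 1 t)"
  have ev: "e \<subseteq> verts (ball_of 1 u)" if "e \<in> edges (ball_of 1 u)" for e u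
    using that by (auto simp: ball_of_def Let_def)
  have "root_of (ball_of 1 s) \<in> verts (ball_of 1 s)"
    using st by (intro root_in_ball) (simp add: locally_finite_tree_def)
  then have "root_deg (ball_of 1 s) = root_deg (ball_of 1 t)"
    by (intro isomorphic_root_deg[OF i] ev)
  then show "root_deg s = root_deg t" using st by (simp only: root_deg_ball)
qed

lemma continuous_on_root_degree:
  fixes g :: "nat \<Rightarrow> 'c::topological_space"
  shows "continuous_on UNIV (\<lambda>t. g (root_degree t))"
proof -
  have "open ((\<lambda>t. g (root_degree t)) -` B)" for B
  proof -
    let ?A = "(\<lambda>t. g (root_degree t)) -` B"
    have "?A = (\<Union>t\<in>?A. {s. ball_eq 1 s t})"
      using ball_eq_refl ball_eq_root_degree by fastforce
    moreover have "open {s. ball_eq 1 s t}" for t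
      unfolding open_ltree_def by (intro generate_topology.Basis) blast
    ultimately show ?thesis by (metis (no_types, lifting) open_UN)
  qed
  then show ?thesis by (simp add: continuous_on_open_vimage)
qed

lemma root_deg_Suc:
  assumes a: "0 \<in> active (uaf x v (Suc n))" and v: "v (Suc n) = 0"
  shows "root_deg (uaf x v (Suc n)) = Suc (root_deg (uaf x v n))"
proof -
  let ?t = "uaf x v n"
  have a0: "0 \<in> active ?t" using active_antimono[OF _ _ a, of n] by simp
  then have T: "uaf x v (Suc n) = attach (Suc n) 0 ?t"
    using a v by (auto simp: active_uaf_Suc simp del: uaf.simps split: if_splits) (simp add: Let_def)
  have n: "{0, Suc n} \<notin> edges ?t"
    using edge_subset_verts[OF tree_uaf, of "{0, Suc n}" x v n] verts_uaf[of "Suc n" x v n] by auto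
  have "{w. {root_of (uaf x v (Suc n)), w} \<in> edges (uaf x v (Suc n))}
      = insert (Suc n) {w. {root_of ?t, w} \<in> edges ?t}"
    unfolding T by (auto simp: attach_def root_uaf doubleton_eq_iff)
  then show ?thesis
    unfolding root_deg_def using finite_root_nbs[OF tree_uaf, of x v n] n by (simp add: root_uaf)
qed

text \<open>A choice of the root either freezes it or gives it a new child, and the former is excluded as
  long as it remains active.\<close>

lemma root_chosen_increases_deg:
  assumes a: "0 \<in> active (uaf x v n)" and i: "m < i" "i \<le> n" "v i = 0"
  shows "root_deg (uaf x v m) < root_deg (uaf x v n)"
proof -
  obtain k where k: "i = Suc k" using i by (cases i) auto
  have "0 \<in> active (uaf x v (Suc k))" using active_antimono[OF i(2) _ a] k by simp
  then have "root_deg (uaf x v (Suc k)) = Suc (root_deg (uaf x v k))"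
    using root_deg_Suc i k by blast
  moreover have "root_deg (uaf x v m) \<le> root_deg (uaf x v k)" "root_deg (uaf x v (Suc k)) \<le> root_deg (uaf x v n)"
    using i k by (auto intro!: root_deg_mono tree_uaf extends_uaf simp del: uaf.simps)
  ultimately show ?thesis by linarith
qed

section \<open>The walk and multiplicative recursions\<close>

lemma walk_Suc: "walk x (Suc n) = walk x n + x (Suc n)"
  by (simp add: walk_def)

lemma walk_pos:
  assumes s: "\<And>i. i \<ge> 1 \<Longrightarrow> x i \<in> {- 1, 1}" and t: "\<tau> x = \<infinity>"
  shows "walk x n \<ge> 1"
proof -
  have nz: "walk x n \<noteq> 0" if "n \<ge> 1" for n
  proof
    assume "walk x n = 0"
    then have "\<tau> x \<le> enat n" using that unfolding \<tau>_def by (intro Inf_lower) blast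
    then show False using t by simp
  qed
  show ?thesis
  proof (induction n)
    case (Suc n)
    then show ?case using s[of "Suc n"] nz[of "Suc n"] by (auto simp: walk_Suc)
  qed (simp add: walk_def)
qed

lemma walk_le:
  assumes s: "\<And>i. i \<ge> 1 \<Longrightarrow> x i \<in> {- 1, 1}"
  shows "walk x n \<le> 1 + int n"
proof (induction n)
  case (Suc n)
  then show ?case using s[of "Suc n"] by (auto simp: walk_Suc)
qed (simp add: walk_def)

lemma not_summable_inverse_walk:
  assumes s: "\<And>i. i \<ge> 1 \<Longrightarrow> x i \<in> {- 1, 1}" and t: "\<tau> x = \<infinity>"
  shows "\<not> summable (\<lambda>n. 1 / real_of_int (walk x n))"
proof
  assume "summable (\<lambda>n. 1 / real_of_int (walk x n))"
  moreover have "norm (1 / real (Suc n)) \<le> 1 / real_of_int (walk x n)" for n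
    using walk_le[of x n, OF s] walk_pos[of x n, OF s t] by (simp add: frac_le)
  ultimately have "summable (\<lambda>n. 1 / real (Suc n))" by (rule summable_comparison_test')
  then have "summable (\<lambda>n. inverse (real n))"
    using summable_Suc_iff[of "\<lambda>n. inverse (real n)"] by (simp only: inverse_eq_divide)
  then show False using not_summable_harmonic[where 'a = real] by simp
qed

text \<open>The conditional probability that a given active vertex is frozen at time \<open>n + 1\<close>, since there
  are then \<open>walk x n\<close> active vertices to choose from.\<close>

definition freeze_rate :: "(nat \<Rightarrow> int) \<Rightarrow> nat \<Rightarrow> real" where
  "freeze_rate x n = of_bool (x (Suc n) = - 1) / real_of_int (walk x n)"

text \<open>The rate is less than one because a down-step from height one would reach zero.\<close>

lemma freeze_rate_bounds:
  assumes s: "\<And>i. i \<ge> 1 \<Longrightarrow> x i \<in> {- 1, 1}" and t: "\<tau> x = \<infinity>"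
  shows "0 \<le> freeze_rate x n" "freeze_rate x n < 1"
  using walk_pos[of x n, OF s t] walk_pos[of x "Suc n", OF s t]
  by (auto simp: freeze_rate_def walk_Suc)

text \<open>The series of interest uses the height after the down-step instead of the height before it;
  the two differ by one, so their ratio is at most two.\<close>

lemma summable_freeze_rate_iff:
  assumes s: "\<And>i. i \<ge> 1 \<Longrightarrow> x i \<in> {- 1, 1}" and t: "\<tau> x = \<infinity>"
  shows "summable (freeze_rate x) \<longleftrightarrow>
    summable (\<lambda>i. 1 / real_of_int (walk x (Suc i)) * of_bool (x (Suc i) = - 1))"
    (is "_ \<longleftrightarrow> summable ?g")
proof
  have le: "freeze_rate x n \<le> ?g n" "?g n \<le> 2 * freeze_rate x n" for n
    using walk_pos[of x n, OF s t] walk_pos[of x "Suc n", OF s t]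
    by (auto simp: freeze_rate_def walk_Suc field_simps)
  have nn: "0 \<le> freeze_rate x n" for n using freeze_rate_bounds[OF s t] by simp
  { assume "summable ?g"
    then show "summable (freeze_rate x)"
      by (rule summable_comparison_test') (use le nn in auto)
  }
  { assume "summable (freeze_rate x)"
    then have "summable (\<lambda>n. 2 * freeze_rate x n)" by (rule summable_mult)
    then show "summable ?g"
      by (rule summable_comparison_test') (use le nn order_trans[OF nn le(1)] in \<open>simp only: real_norm_def abs_of_nonneg\<close>)
  }
qed

text \<open>The sequence decreases to some \<open>L \<ge> 0\<close> and its decrements are at least \<open>L * c n\<close>. They
  telescope to a finite sum, which is compatible with a divergent series of \<open>c\<close> only if \<open>L = 0\<close>.\<close>

lemma multiplicative_decay_tendsto_0:
  fixes a c :: "nat \<Rightarrow> real"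
  assumes rec: "\<And>n. n \<ge> m \<Longrightarrow> a (Suc n) = a n * (1 - c n)"
    and c: "\<And>n. 0 \<le> c n" and a: "\<And>n. 0 \<le> a n" and ns: "\<not> summable c"
  shows "a \<longlonglongrightarrow> 0"
proof -
  define b where "b n = a (n + m)" for n
  have rb: "b (Suc n) = b n - b n * c (n + m)" for n
    using rec[of "n + m"] by (simp add: b_def algebra_simps)
  have "b (Suc n) \<le> b n" for n using rb[of n] a[of "n + m"] c[of "n + m"] by (simp add: b_def)
  then have dec: "decseq b" by (rule decseq_SucI)
  moreover have "0 \<le> b n" for n using a by (simp add: b_def)
  ultimately obtain L where L: "b \<longlonglongrightarrow> L" "\<And>i. L \<le> b i"
    using decseq_convergent[of b 0] by blast
  have "0 \<le> L" by (rule LIMSEQ_le_const[OF L(1)]) (use a in \<open>auto simp: b_def\<close>)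
  have "L = 0"
  proof (rule ccontr)
    assume "L \<noteq> 0"
    with \<open>0 \<le> L\<close> have pos: "0 < L" by simp
    have "summable (\<lambda>n. b n - b (Suc n))" using telescope_summable'[OF L(1)] .
    then have "summable (\<lambda>n. (b n - b (Suc n)) / L)" by (rule summable_divide)
    moreover have "norm (c (n + m)) \<le> (b n - b (Suc n)) / L" for n
      using c[of "n + m"] L(2)[of n] pos mult_right_mono[of L "b n" "c (n + m)"]
      by (simp add: rb field_simps)
    ultimately have "summable (\<lambda>n. c (n + m))" by (rule summable_comparison_test')
    then show False using ns summable_iff_shift by blast
  qed
  then have "(\<lambda>n. a (n + m)) \<longlonglongrightarrow> 0" using L(1) unfolding b_def by simp
  then show ?thesis by (rule LIMSEQ_offset)
qed

text \<open>Once the tail of the series of \<open>c\<close> is below one half, the sequence loses at most half of its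
  value, by the inequality \<open>1 - (\<Sum>i. c i) \<le> (\<Prod>i. 1 - c i)\<close>, which the induction reproves.\<close>

lemma multiplicative_decay_bounded_below:
  fixes a c :: "nat \<Rightarrow> real"
  assumes rec: "\<And>n. a (Suc n) = a n * (1 - c n)" and a0: "0 < a 0"
    and c: "\<And>n. 0 \<le> c n" "\<And>n. c n < 1" and sc: "summable c"
  shows "\<exists>\<delta>>0. \<forall>n. \<delta> \<le> a n"
proof -
  have pos: "0 < a n" for n by (induction n) (use a0 rec c in auto)
  have "a (Suc n) \<le> a n" for n
    using pos[of n] c(1)[of n] by (simp add: rec algebra_simps)
  then have dec: "decseq a" by (rule decseq_SucI)
  have "\<exists>N. \<forall>n\<ge>N. norm (\<Sum>i. c (i + n)) < 1 / 2"
    by (rule suminf_exist_split) (use sc in auto)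
  then obtain N where "norm (\<Sum>i. c (i + N)) < 1 / 2" by blast
  then have N: "(\<Sum>i. c (i + N)) < 1 / 2" by (simp add: abs_less_iff)
  have ge: "a N * (1 - (\<Sum>i<n. c (i + N))) \<le> a (n + N)" for n
  proof (induction n)
    case (Suc n)
    have "a (n + N) * c (n + N) \<le> a N * c (n + N)"
      using decseqD[OF dec, of N "n + N"] c(1) by (intro mult_right_mono) auto
    with Suc show ?case by (simp add: rec algebra_simps)
  qed simp
  have "a N / 2 \<le> a n" for n
  proof (cases "n < N")
    case True
    then show ?thesis using decseqD[OF dec, of n N] pos[of N] by simp
  next
    case False
    have "(\<Sum>i<n - N. c (i + N)) \<le> (\<Sum>i. c (i + N))"
      using sc c(1) by (intro sum_le_suminf) (auto simp: summable_iff_shift)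
    then have "a N * (1 / 2) \<le> a N * (1 - (\<Sum>i<n - N. c (i + N)))"
      using N pos[of N] by (intro mult_left_mono) auto
    then show ?thesis using ge[of "n - N"] False by simp
  qed
  then show ?thesis using pos[of N] by (intro exI[of _ "a N / 2"]) auto
qed

section \<open>The law of the choices\<close>

definition history :: "(nat \<Rightarrow> nat) \<Rightarrow> nat \<Rightarrow> nat list" where
  "history v n = map v [1..<Suc n]"

definition choice_at :: "nat list \<Rightarrow> nat \<Rightarrow> nat" where
  "choice_at h i = h ! (i - 1)"

lemma history_0: "history v 0 = []"
  by (simp add: history_def)

lemma history_Suc: "history v (Suc n) = history v n @ [v (Suc n)]"
  by (simp add: history_def)

lemma length_history: "length (history v n) = n"
  by (simp add: history_def)

lemma choice_at_history: "1 \<le> i \<Longrightarrow> i \<le> n \<Longrightarrow> choice_at (history v n) i = v i"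
proof (induction n)
  case (Suc n)
  then show ?case by (cases "i = Suc n") (auto simp: history_Suc choice_at_def nth_append length_history)
qed simp

lemma choice_at_append: "1 \<le> i \<Longrightarrow> i \<le> length h \<Longrightarrow> choice_at (h @ [u]) i = choice_at h i"
  by (cases i) (simp_all add: choice_at_def nth_append)

lemma choice_at_last: "length h = n \<Longrightarrow> choice_at (h @ [u]) (Suc n) = u"
  by (simp add: choice_at_def nth_append)

lemma history_eq_iff: "length h = n \<Longrightarrow> history v n = h \<longleftrightarrow> (\<forall>i\<in>{1..n}. v i = choice_at h i)"
proof
  assume l: "length h = n" and v: "\<forall>i\<in>{1..n}. v i = choice_at h i"
  show "history v n = h"
  proof (rule nth_equalityI)
    fix i assume i: "i < length (history v n)"
    then have "history v n ! i = choice_at (history v n) (Suc i)" by (simp add: choice_at_def)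
    also have "\<dots> = v (Suc i)" using i by (intro choice_at_history) (auto simp: length_history)
    also have "\<dots> = h ! i" using v i by (simp add: length_history choice_at_def)
    finally show "history v n ! i = h ! i" .
  qed (simp add: l length_history)
next
  assume "history v n = h"
  then show "\<forall>i\<in>{1..n}. v i = choice_at h i" using choice_at_history by fastforce
qed

text \<open>The functionals of the choices that depend on the history up to time \<open>n\<close> only. Finite histories
  form a countable set, so these functionals are automatically measurable, and their laws are
  determined by the probabilities of the single histories.\<close>

definition determined :: "nat \<Rightarrow> ((nat \<Rightarrow> nat) \<Rightarrow> 'c) \<Rightarrow> bool" where
  "determined n F \<longleftrightarrow> (\<forall>v w. (\<forall>i\<in>{1..n}. v i = w i) \<longrightarrow> F v = F w)"

lemma determined_uaf: "k \<le> n \<Longrightarrow> determined n (\<lambda>v. F (uaf x v k))"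
  unfolding determined_def by (intro allI impI arg_cong[of _ _ F] uaf_cong) auto

lemma determined_choice: "1 \<le> i \<Longrightarrow> i \<le> n \<Longrightarrow> determined n (\<lambda>v. F (v i))"
  unfolding determined_def by auto

lemma determined_combine:
  "determined n F \<Longrightarrow> determined n G \<Longrightarrow> determined n (\<lambda>v. H (F v) (G v))"
  unfolding determined_def by metis

lemma determined_mono: "determined m F \<Longrightarrow> m \<le> n \<Longrightarrow> determined n F"
  unfolding determined_def by auto

lemma determined_history: "determined n F \<Longrightarrow> F (choice_at (history v n)) = F v"
  unfolding determined_def using choice_at_history by auto

text \<open>When no vertex is active, \<open>pmf_of_set\<close> has no meaningful value; the histories that lead there have
  probability zero as long as the walk stays positive.\<close>

primrec choice_law :: "(nat \<Rightarrow> int) \<Rightarrow> nat \<Rightarrow> nat list pmf" where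
  "choice_law x 0 = return_pmf []"
| "choice_law x (Suc n) = bind_pmf (choice_law x n)
     (\<lambda>h. map_pmf (\<lambda>u. h @ [u]) (pmf_of_set (active (uaf x (choice_at h) n))))"

text \<open>Along every history that the process can follow, each step changes the number of active
  vertices by exactly the increment of the walk.\<close>

lemma choice_law_support:
  assumes w: "\<And>k. walk x k \<ge> 1" and s: "\<And>i. i \<ge> 1 \<Longrightarrow> x i \<in> {- 1, 1}"
  shows "h \<in> set_pmf (choice_law x n) \<Longrightarrow>
    length h = n \<and> int (card (active (uaf x (choice_at h) n))) = walk x n"
proof (induction n arbitrary: h)
  case 0
  then show ?case by (simp add: walk_def active_def) (simp add: single_vertex_def)
next
  case (Suc n)
  obtain g where g: "g \<in> set_pmf (choice_law x n)"
    "h \<in> set_pmf (map_pmf (\<lambda>u. g @ [u]) (pmf_of_set (active (uaf x (choice_at g) n))))"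
    using Suc.prems by auto
  let ?A = "active (uaf x (choice_at g) n)"
  have l: "length g = n" and card: "int (card ?A) = walk x n" using Suc.IH[OF g(1)] by auto
  have "?A \<noteq> {}" using card w[of n] by auto
  then obtain u where u: "h = g @ [u]" "u \<in> ?A" using g(2) finite_active by auto
  have same: "uaf x (choice_at (g @ [u])) n = uaf x (choice_at g) n"
    by (rule uaf_cong) (simp add: l choice_at_append)
  have "card ?A \<noteq> 0" using card w[of n] by auto
  moreover have "Suc n \<notin> ?A" using verts_uaf[of "Suc n" x "choice_at g" n] by (auto simp: active_def)
  ultimately have "int (card (active (uaf x (choice_at (g @ [u])) (Suc n)))) = walk x (Suc n)"
    using u card s[of "Suc n"] finite_active[of x "choice_at g" n]
    unfolding active_uaf_Suc same choice_at_last[OF l] walk_Suc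
    by (auto simp: card_Diff_singleton of_nat_diff card_gt_0_iff Suc_le_eq)
  then show ?case using l u(1) by (simp del: uaf.simps)
qed

lemma pmf_choice_law_Suc:
  "pmf (choice_law x (Suc n)) (h @ [u]) =
    pmf (choice_law x n) h * pmf (pmf_of_set (active (uaf x (choice_at h) n))) u"
proof -
  let ?q = "\<lambda>h. pmf_of_set (active (uaf x (choice_at h) n))"
  have "pmf (map_pmf (\<lambda>u. g @ [u]) (?q g)) (h @ [u]) = indicator {h} g * pmf (?q h) u" for g
  proof (cases "g = h")
    case True
    have "inj (\<lambda>u. h @ [u])" by (simp add: inj_def)
    then have "pmf (map_pmf (\<lambda>u. h @ [u]) (?q h)) (h @ [u]) = pmf (?q h) u" by (rule pmf_map_inj')
    then show ?thesis using True by simp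
  next
    case False
    then have "h @ [u] \<notin> (\<lambda>u. g @ [u]) ` set_pmf (?q g)" by auto
    then show ?thesis using False by (simp add: pmf_map_outside)
  qed
  then have "pmf (choice_law x (Suc n)) (h @ [u]) =
    (LINT g|choice_law x n. indicator {h} g * pmf (?q h) u)"
    by (simp add: pmf_bind)
  then show ?thesis by (simp add: measure_pmf_single)
qed

locale uaf_process = prob_space M for M :: "'w measure" +
  fixes x :: "nat \<Rightarrow> int" and V :: "nat \<Rightarrow> 'w \<Rightarrow> nat"
  assumes uniform: "uniform_choices M x V"
begin

abbreviation choices :: "'w \<Rightarrow> nat \<Rightarrow> nat" where
  "choices \<omega> \<equiv> \<lambda>i. V i \<omega>"

lemma measurable_history: "(\<lambda>\<omega>. history (choices \<omega>) n) \<in> M \<rightarrow>\<^sub>M count_space UNIV"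
proof (induction n)
  case (Suc n)
  have "V (Suc n) \<in> M \<rightarrow>\<^sub>M count_space UNIV" using uniform by (simp add: uniform_choices_def)
  then have "(\<lambda>\<omega>. h @ [V (Suc n) \<omega>]) \<in> M \<rightarrow>\<^sub>M count_space UNIV" for h
    by (rule measurable_compose) simp
  from measurable_compose_countable[OF this Suc] show ?case by (simp add: history_Suc)
qed (simp add: history_0)

lemma measurable_determined:
  assumes "determined n F"
  shows "(\<lambda>\<omega>. F (choices \<omega>)) \<in> M \<rightarrow>\<^sub>M count_space UNIV"
proof -
  have "(\<lambda>\<omega>. F (choice_at (history (choices \<omega>) n))) \<in> M \<rightarrow>\<^sub>M count_space UNIV"
    by (rule measurable_compose[OF measurable_history]) simp
  then show ?thesis using assms by (simp add: determined_history)
qed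

lemma determined_event:
  assumes "determined n Q"
  shows "{\<omega> \<in> space M. Q (choices \<omega>)} \<in> events"
proof -
  have "(\<lambda>\<omega>. Q (choices \<omega>)) -` {True} \<inter> space M \<in> events"
    by (rule measurable_sets[OF measurable_determined[OF assms]]) simp
  moreover have "(\<lambda>\<omega>. Q (choices \<omega>)) -` {True} \<inter> space M = {\<omega> \<in> space M. Q (choices \<omega>)}"
    by auto
  ultimately show ?thesis by simp
qed

end

text \<open>The driving sequence \<open>x\<close> is only known to agree with the immortal sequence \<open>y\<close> up to time \<open>N\<close>;
  up to that time the law of the process is the one prescribed by \<open>y\<close>. Both the approximating
  processes and, with \<open>x = y\<close>, the limiting one are instances.\<close>

locale agreeing_uaf = uaf_process M x V for M :: "'w measure" and x V +
  fixes y :: "nat \<Rightarrow> int" and N :: nat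
  assumes steps: "\<And>i. i \<ge> 1 \<Longrightarrow> y i \<in> {- 1, 1}" and immortal: "\<tau> y = \<infinity>"
    and agree: "\<And>i. 1 \<le> i \<Longrightarrow> i \<le> N \<Longrightarrow> x i = y i"
begin

lemma prob_history:
  "n \<le> N \<Longrightarrow> prob {\<omega> \<in> space M. history (choices \<omega>) n = h} = pmf (choice_law y n) h"
proof (induction n arbitrary: h)
  case 0
  then show ?case by (cases "h = []") (simp_all add: history_0 prob_space)
next
  case (Suc n)
  show ?case
  proof (cases h rule: rev_cases)
    case Nil
    then show ?thesis by (auto simp: history_Suc pmf_eq_0_set_pmf)
  next
    case (snoc g u)
    let ?A = "active (uaf y (choice_at g) n)"
    have IH: "prob {\<omega> \<in> space M. history (choices \<omega>) n = g} = pmf (choice_law y n) g"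
      using Suc by simp
    have ev: "{\<omega> \<in> space M. history (choices \<omega>) n = g} \<in> events"
      by (rule determined_event[of n]) (auto simp: determined_def history_def simp del: upt_Suc cong: map_cong)
    have eq: "{\<omega> \<in> space M. history (choices \<omega>) (Suc n) = h} =
      {\<omega> \<in> space M. V (Suc n) \<omega> = u \<and> history (choices \<omega>) n = g}"
      by (auto simp: history_Suc snoc)
    show ?thesis
    proof (cases "pmf (choice_law y n) g = 0")
      case True
      have "prob {\<omega> \<in> space M. V (Suc n) \<omega> = u \<and> history (choices \<omega>) n = g} \<le>
        prob {\<omega> \<in> space M. history (choices \<omega>) n = g}"
        by (rule finite_measure_mono[OF _ ev]) auto
      then show ?thesis unfolding eq unfolding snoc pmf_choice_law_Suc IH True
        by (simp add: measure_le_0_iff)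
    next
      case False
      then have "g \<in> set_pmf (choice_law y n)" by (simp add: pmf_eq_0_set_pmf)
      then have l: "length g = n" and card: "int (card ?A) = walk y n"
        using choice_law_support[of y g n] walk_pos[of y] steps immortal by auto
      have same: "uaf x (choice_at g) n = uaf y (choice_at g) n"
        by (rule uaf_prefix_cong) (use agree Suc.prems in auto)
      have ne: "active (uaf x (choice_at g) n) \<noteq> {}"
        using card walk_pos[OF steps immortal, of n] unfolding same by auto
      have hist: "history (choices \<omega>) n = g \<longleftrightarrow> (\<forall>i\<in>{1..n}. V i \<omega> = choice_at g i)" for \<omega>
        by (rule history_eq_iff[OF l])
      have pos: "prob {\<omega> \<in> space M. \<forall>i\<in>{1..n}. V i \<omega> = choice_at g i} > 0"
        unfolding hist[symmetric] IH using False by (simp add: pmf_pos)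
      have "\<P>(\<omega> in M. V (Suc n) \<omega> = u \<bar> \<forall>i\<in>{1..n}. V i \<omega> = choice_at g i) = pmf (pmf_of_set ?A) u"
        using uniform ne pos unfolding uniform_choices_def same[symmetric] by blast
      then show ?thesis unfolding eq unfolding snoc pmf_choice_law_Suc cond_prob_def hist[symmetric] IH
        using False by (simp add: field_simps)
    qed
  qed
qed

lemma distr_history:
  assumes "n \<le> N"
  shows "distr M (count_space UNIV) (\<lambda>\<omega>. history (choices \<omega>) n) = measure_pmf (choice_law y n)"
proof (rule measure_eqI_countable[where A = UNIV])
  fix h :: "nat list"
  have "emeasure (distr M (count_space UNIV) (\<lambda>\<omega>. history (choices \<omega>) n)) {h}
    = emeasure M {\<omega> \<in> space M. history (choices \<omega>) n = h}"
    by (subst emeasure_distr[OF measurable_history]) (auto intro!: arg_cong[of _ _ "emeasure M"])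
  also have "\<dots> = emeasure (measure_pmf (choice_law y n)) {h}"
    using prob_history[OF assms] by (simp add: emeasure_eq_measure emeasure_pmf_single)
  finally show "emeasure (distr M (count_space UNIV) (\<lambda>\<omega>. history (choices \<omega>) n)) {h} =
    emeasure (measure_pmf (choice_law y n)) {h}" .
qed auto

lemma expectation_determined:
  fixes F :: "(nat \<Rightarrow> nat) \<Rightarrow> real"
  assumes F: "determined n F" and n: "n \<le> N"
  shows "expectation (\<lambda>\<omega>. F (choices \<omega>)) = (LINT h|choice_law y n. F (choice_at h))"
proof -
  have "(LINT h|choice_law y n. F (choice_at h)) =
    (LINT h|distr M (count_space UNIV) (\<lambda>\<omega>. history (choices \<omega>) n). F (choice_at h))"
    by (simp only: distr_history[OF n])
  also have "\<dots> = expectation (\<lambda>\<omega>. F (choice_at (history (choices \<omega>) n)))"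
    by (rule integral_distr[OF measurable_history]) simp
  finally show ?thesis using F by (simp add: determined_history)
qed

lemma prob_determined:
  assumes Q: "determined n Q" and n: "n \<le> N"
  shows "prob {\<omega> \<in> space M. Q (choices \<omega>)} = measure_pmf.prob (choice_law y n) {h. Q (choice_at h)}"
proof -
  have "measure_pmf.prob (choice_law y n) {h. Q (choice_at h)} =
    measure (distr M (count_space UNIV) (\<lambda>\<omega>. history (choices \<omega>) n)) {h. Q (choice_at h)}"
    by (simp only: distr_history[OF n])
  also have "\<dots> = prob {\<omega> \<in> space M. Q (choice_at (history (choices \<omega>) n))}"
    by (subst measure_distr[OF measurable_history]) (auto intro!: arg_cong[of _ _ "prob"])
  finally show ?thesis using Q by (simp add: determined_history)
qed

text \<open>Conditionally on any event of the past on which \<open>u\<close> is active, the next choice is uniform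
  among the \<open>walk y n\<close> active vertices.\<close>

lemma prob_choose_active:
  assumes Q: "determined n Q" and act: "\<And>v. Q v \<Longrightarrow> u \<in> active (uaf y v n)" and n: "Suc n \<le> N"
  shows "prob {\<omega> \<in> space M. Q (choices \<omega>) \<and> V (Suc n) \<omega> = u} =
    prob {\<omega> \<in> space M. Q (choices \<omega>)} / real_of_int (walk y n)"
proof -
  let ?q = "\<lambda>h. pmf_of_set (active (uaf y (choice_at h) n))"
  let ?B = "{h. Q (choice_at h)}"
  let ?E = "{h. Q (choice_at h) \<and> choice_at h (Suc n) = u}"
  have wp: "walk y k \<ge> 1" for k using walk_pos[OF steps immortal] .
  have step: "emeasure (?q h) ((\<lambda>u. h @ [u]) -` ?E) = ennreal (1 / real_of_int (walk y n)) * indicator ?B h"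
    if h: "h \<in> set_pmf (choice_law y n)" for h
  proof -
    have l: "length h = n" and card: "int (card (active (uaf y (choice_at h) n))) = walk y n"
      using choice_law_support[OF wp steps h] by auto
    have ne: "active (uaf y (choice_at h) n) \<noteq> {}" using card wp[of n] by auto
    have "Q (choice_at (h @ [w])) = Q (choice_at h)" for w
      using Q l choice_at_append[of _ h w] unfolding determined_def by (metis atLeastAtMost_iff)
    then have "(\<lambda>u. h @ [u]) -` ?E = (if Q (choice_at h) then {u} else {})"
      using l by (auto simp: choice_at_last)
    moreover have "pmf (?q h) u = 1 / real_of_int (walk y n)" if "Q (choice_at h)"
      using act[OF that] ne finite_active[of y "choice_at h" n] by (simp flip: card)
    ultimately show ?thesis by (simp add: emeasure_pmf_single)
  qed
  have "emeasure (choice_law y (Suc n)) ?E =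
    (\<integral>\<^sup>+ h. ennreal (1 / real_of_int (walk y n)) * indicator ?B h \<partial>choice_law y n)"
    by (simp only: choice_law.simps emeasure_bind_pmf emeasure_map_pmf)
      (rule nn_integral_cong_AE, simp add: AE_measure_pmf_iff step del: vimage_Collect_eq)
  also have "\<dots> = ennreal (1 / real_of_int (walk y n)) * emeasure (choice_law y n) ?B"
    by (simp add: nn_integral_cmult)
  finally have "measure_pmf.prob (choice_law y (Suc n)) ?E =
    1 / real_of_int (walk y n) * measure_pmf.prob (choice_law y n) ?B"
    using wp[of n] by (simp add: measure_pmf.emeasure_eq_measure flip: ennreal_mult)
  moreover have "determined (Suc n) (\<lambda>v. Q v \<and> v (Suc n) = u)"
    by (intro determined_combine[where H = "(\<and>)"] determined_mono[OF Q] determined_choice) auto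
  then have "prob {\<omega> \<in> space M. Q (choices \<omega>) \<and> V (Suc n) \<omega> = u} = measure_pmf.prob (choice_law y (Suc n)) ?E"
    by (rule prob_determined) (rule n)
  moreover have "prob {\<omega> \<in> space M. Q (choices \<omega>)} = measure_pmf.prob (choice_law y n) ?B"
    by (rule prob_determined[OF Q]) (use n in simp)
  ultimately show ?thesis by (simp del: choice_law.simps)
qed

end

section \<open>Long-time behaviour of the process\<close>

locale immortal_uaf = uaf_process +
  assumes steps: "\<And>i. i \<ge> 1 \<Longrightarrow> x i \<in> {- 1, 1}" and immortal: "\<tau> x = \<infinity>"
begin

lemma agreeing_self: "agreeing_uaf M x V x N"
  by unfold_locales (use steps immortal in auto)

lemmas prob_choose = agreeing_uaf.prob_choose_active[OF agreeing_self _ _ order_refl]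

definition active_prob :: "nat \<Rightarrow> nat \<Rightarrow> real" where
  "active_prob j n = prob {\<omega> \<in> space M. j \<in> active (uaf x (choices \<omega>) n)}"

lemma active_prob_Suc:
  assumes j: "j \<le> n"
  shows "active_prob j (Suc n) = active_prob j n * (1 - freeze_rate x n)"
proof -
  let ?A = "{\<omega> \<in> space M. j \<in> active (uaf x (choices \<omega>) n)}"
  let ?B = "{\<omega> \<in> space M. j \<in> active (uaf x (choices \<omega>) n) \<and> V (Suc n) \<omega> = j}"
  have jn: "j \<noteq> Suc n" using j by simp
  show ?thesis
  proof (cases "x (Suc n) = - 1")
    case True
    have dA: "determined n (\<lambda>v. j \<in> active (uaf x v n))" by (rule determined_uaf) simp
    have dB: "determined (Suc n) (\<lambda>v. j \<in> active (uaf x v n) \<and> v (Suc n) = j)"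
      by (intro determined_combine[where H = "(\<and>)"] determined_mono[OF dA] determined_choice) auto
    have "{\<omega> \<in> space M. j \<in> active (uaf x (choices \<omega>) (Suc n))} = ?A - ?B"
      using True by (auto simp: active_uaf_Suc simp del: uaf.simps)
    then have "active_prob j (Suc n) = prob (?A - ?B)" by (simp only: active_prob_def)
    also have "\<dots> = prob ?A - prob ?B"
      using determined_event[OF dA] determined_event[OF dB] by (intro finite_measure_Diff) auto
    also have "prob ?B = prob ?A / real_of_int (walk x n)" by (rule prob_choose[OF dA])
    finally show ?thesis using True by (simp add: active_prob_def freeze_rate_def algebra_simps)
  next
    case False
    then have "j \<in> active (uaf x v (Suc n)) \<longleftrightarrow> j \<in> active (uaf x v n)" for v
      using jn by (simp add: active_uaf_Suc del: uaf.simps)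
    then have "active_prob j (Suc n) = active_prob j n" by (simp only: active_prob_def)
    then show ?thesis using False by (simp add: freeze_rate_def)
  qed
qed

text \<open>The probability that \<open>j\<close> is still active is multiplied by \<open>1 - freeze_rate x n\<close> at every step,
  so it tends to zero when the rates have infinite sum.\<close>

lemma AE_settles:
  assumes "\<not> summable (freeze_rate x)"
  shows "AE \<omega> in M. settles x (choices \<omega>)"
  unfolding settles_def AE_all_countable
proof
  fix j
  let ?E = "\<lambda>n. {\<omega> \<in> space M. j \<in> active (uaf x (choices \<omega>) n)}"
  have ev: "?E n \<in> events" for n by (rule determined_event[of n]) (rule determined_uaf, simp)
  have "0 \<le> active_prob j n" for n by (simp add: active_prob_def)
  then have "active_prob j \<longlonglongrightarrow> 0"
    using multiplicative_decay_tendsto_0[of j "active_prob j" "freeze_rate x", OF active_prob_Suc]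
      freeze_rate_bounds(1)[OF steps immortal] assms by blast
  moreover have "prob (\<Inter>n\<in>{j..}. ?E n) \<le> active_prob j n" if "n \<ge> j" for n
    unfolding active_prob_def using that by (intro finite_measure_mono ev) auto
  ultimately have "prob (\<Inter>n\<in>{j..}. ?E n) \<le> 0"
    by (intro LIMSEQ_le_const[of "active_prob j"]) auto
  then have "(\<Inter>n\<in>{j..}. ?E n) \<in> null_sets M"
    using ev by (intro null_setsI sets.countable_INT') (auto simp: emeasure_eq_measure measure_le_0_iff)
  then show "AE \<omega> in M. \<exists>m\<ge>j. j \<notin> active (uaf x (choices \<omega>) m)"
    by (rule AE_I') auto
qed

definition never_chosen_prob :: "nat \<Rightarrow> nat \<Rightarrow> real" where
  "never_chosen_prob m n = prob {\<omega> \<in> space M. 0 \<in> active (uaf x (choices \<omega>) n) \<and>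
     (\<forall>i\<in>{m<..n}. V i \<omega> \<noteq> 0)}"

lemma never_chosen_prob_Suc:
  assumes m: "m \<le> n"
  shows "never_chosen_prob m (Suc n) = never_chosen_prob m n * (1 - 1 / real_of_int (walk x n))"
proof -
  let ?Q = "\<lambda>v. 0 \<in> active (uaf x v n) \<and> (\<forall>i\<in>{m<..n}. v i \<noteq> 0)"
  let ?A = "{\<omega> \<in> space M. ?Q (choices \<omega>)}"
  let ?B = "{\<omega> \<in> space M. ?Q (choices \<omega>) \<and> V (Suc n) \<omega> = 0}"
  have "determined n (\<lambda>v. \<forall>i\<in>{m<..n}. v i \<noteq> (0::nat))" by (auto simp: determined_def)
  then have dA: "determined n ?Q"
    by (intro determined_combine[where H = "(\<and>)"] determined_uaf) auto
  have dB: "determined (Suc n) (\<lambda>v. ?Q v \<and> v (Suc n) = 0)"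
    by (intro determined_combine[where H = "(\<and>)" and F = ?Q] determined_mono[OF dA] determined_choice) auto
  have ins: "{m<..Suc n} = insert (Suc n) {m<..n}" using m by auto
  have "{\<omega> \<in> space M. 0 \<in> active (uaf x (choices \<omega>) (Suc n)) \<and> (\<forall>i\<in>{m<..Suc n}. V i \<omega> \<noteq> 0)} = ?A - ?B"
    unfolding ins by (auto simp: active_uaf_Suc simp del: uaf.simps split: if_splits)
  then have "never_chosen_prob m (Suc n) = prob (?A - ?B)" by (simp only: never_chosen_prob_def)
  also have "\<dots> = prob ?A - prob ?B"
    using determined_event[OF dA] determined_event[OF dB] by (intro finite_measure_Diff) auto
  also have "prob ?B = prob ?A / real_of_int (walk x n)" by (rule prob_choose[OF dA]) simp
  finally show ?thesis by (simp add: never_chosen_prob_def algebra_simps)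
qed

text \<open>The walk grows at most linearly, so the probabilities \<open>1 / walk x n\<close> of choosing the root have
  infinite sum by comparison with the harmonic series: an active root is chosen again and again.\<close>

lemma never_chosen_prob_tendsto_0: "never_chosen_prob m \<longlonglongrightarrow> 0"
proof (rule multiplicative_decay_tendsto_0[where m = m and c = "\<lambda>n. 1 / real_of_int (walk x n)"])
  show "never_chosen_prob m (Suc n) = never_chosen_prob m n * (1 - 1 / real_of_int (walk x n))"
    if "m \<le> n" for n using that by (rule never_chosen_prob_Suc)
  show "0 \<le> 1 / real_of_int (walk x n)" for n using walk_pos[OF steps immortal, of n] by simp
  show "0 \<le> never_chosen_prob m n" for n by (simp add: never_chosen_prob_def)
qed (rule not_summable_inverse_walk[OF steps immortal])

text \<open>Induction on \<open>k\<close>: if the root is active at time \<open>n\<close> with degree at most \<open>k\<close>, then for each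
  earlier time \<open>m\<close> either it has not been chosen since \<open>m\<close>, which is unlikely for large \<open>n\<close>, or its
  degree at time \<open>m\<close> was less than \<open>k\<close>, which is unlikely for large \<open>m\<close>.\<close>

lemma active_root_degree_diverges:
  "(\<lambda>n. prob {\<omega> \<in> space M. 0 \<in> active (uaf x (choices \<omega>) n) \<and>
     root_deg (uaf x (choices \<omega>) n) < k}) \<longlonglongrightarrow> 0"
proof (induction k)
  case (Suc k)
  let ?D = "\<lambda>k n. {\<omega> \<in> space M. 0 \<in> active (uaf x (choices \<omega>) n) \<and> root_deg (uaf x (choices \<omega>) n) < k}"
  let ?E = "\<lambda>m n. {\<omega> \<in> space M. 0 \<in> active (uaf x (choices \<omega>) n) \<and> (\<forall>i\<in>{m<..n}. V i \<omega> \<noteq> 0)}"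
  have evD: "?D k n \<in> events" for k n
    by (rule determined_event[of n]) (rule determined_uaf[where F = "\<lambda>t. 0 \<in> active t \<and> root_deg t < k"], simp)
  have evE: "?E m n \<in> events" for m n
  proof (rule determined_event[of n])
    have "determined n (\<lambda>v. \<forall>i\<in>{m<..n}. v i \<noteq> (0::nat))" by (auto simp: determined_def)
    then show "determined n (\<lambda>v. 0 \<in> active (uaf x v n) \<and> (\<forall>i\<in>{m<..n}. v i \<noteq> 0))"
      by (intro determined_combine[where H = "(\<and>)"] determined_uaf) auto
  qed
  have le: "prob (?D (Suc k) n) \<le> prob (?D k m) + never_chosen_prob m n" if mn: "m \<le> n" for m n
  proof -
    have "?D (Suc k) n \<subseteq> ?D k m \<union> ?E m n"
    proof
      fix \<omega> assume w: "\<omega> \<in> ?D (Suc k) n"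
      show "\<omega> \<in> ?D k m \<union> ?E m n"
      proof (cases "\<forall>i\<in>{m<..n}. V i \<omega> \<noteq> 0")
        case False
        then obtain i where i: "m < i" "i \<le> n" "V i \<omega> = 0" by auto
        then have "root_deg (uaf x (choices \<omega>) m) < root_deg (uaf x (choices \<omega>) n)"
          using w root_chosen_increases_deg[of x "choices \<omega>" n m i] by simp
        moreover have "0 \<in> active (uaf x (choices \<omega>) m)"
          using w active_antimono[OF mn, of 0] by auto
        ultimately show ?thesis using w by auto
      qed (use w in auto)
    qed
    then have "prob (?D (Suc k) n) \<le> prob (?D k m \<union> ?E m n)"
      by (rule finite_measure_mono) (intro sets.Un evD evE)
    also have "\<dots> \<le> prob (?D k m) + never_chosen_prob m n"
      unfolding never_chosen_prob_def by (rule measure_Un_le[OF evD evE])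
    finally show ?thesis .
  qed
  show ?case
  proof (rule LIMSEQ_I)
    fix e :: real assume e: "0 < e"
    have "\<forall>\<^sub>F n in sequentially. prob (?D k n) < e / 2"
      using Suc e by (intro order_tendstoD) auto
    then obtain m where m: "prob (?D k m) < e / 2" by (auto simp: eventually_sequentially)
    have "\<forall>\<^sub>F n in sequentially. never_chosen_prob m n < e / 2"
      using never_chosen_prob_tendsto_0 e by (intro order_tendstoD) auto
    then obtain n0 where n0: "\<And>n. n \<ge> n0 \<Longrightarrow> never_chosen_prob m n < e / 2"
      by (auto simp: eventually_sequentially)
    have "norm (prob (?D (Suc k) n) - 0) < e" if "n \<ge> max n0 m" for n
      using le[of m n] m n0[of n] that by simp
    then show "\<exists>no. \<forall>n\<ge>no. norm (prob (?D (Suc k) n) - 0) < e" by blast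
  qed
qed simp

text \<open>If the freezing rates are summable, then the root stays active with a probability bounded away
  from zero, and on this event its degree exceeds any given bound eventually.\<close>

lemma root_degree_not_tight:
  assumes "summable (freeze_rate x)"
  shows "\<exists>\<delta>>0. \<forall>k. \<exists>n. \<delta> \<le> prob {\<omega> \<in> space M. k \<le> root_deg (uaf x (choices \<omega>) n)}"
proof -
  have a0: "active_prob 0 0 = 1"
    by (simp add: active_prob_def active_def) (simp add: single_vertex_def prob_space)
  obtain \<delta> where d: "\<delta> > 0" "\<And>n. \<delta> \<le> active_prob 0 n"
    using multiplicative_decay_bounded_below[of "active_prob 0" "freeze_rate x"]
      active_prob_Suc[of 0] a0 freeze_rate_bounds[OF steps immortal] assms by auto
  have "\<exists>n. \<delta> / 2 \<le> prob {\<omega> \<in> space M. k \<le> root_deg (uaf x (choices \<omega>) n)}" for k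
  proof -
    let ?D = "\<lambda>n. {\<omega> \<in> space M. 0 \<in> active (uaf x (choices \<omega>) n) \<and> root_deg (uaf x (choices \<omega>) n) < k}"
    let ?G = "\<lambda>n. {\<omega> \<in> space M. k \<le> root_deg (uaf x (choices \<omega>) n)}"
    have "\<forall>\<^sub>F n in sequentially. prob (?D n) < \<delta> / 2"
      using active_root_degree_diverges[of k] d by (intro order_tendstoD) auto
    then obtain n where n: "prob (?D n) < \<delta> / 2" by (auto simp: eventually_sequentially)
    have evD: "?D n \<in> events"
      by (rule determined_event[of n]) (rule determined_uaf[where F = "\<lambda>t. 0 \<in> active t \<and> root_deg t < k"], simp)
    have evG: "?G n \<in> events"
      by (rule determined_event[of n]) (rule determined_uaf, simp)
    have "active_prob 0 n \<le> prob (?D n \<union> ?G n)"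
      unfolding active_prob_def by (rule finite_measure_mono) (use evD evG in auto)
    also have "\<dots> \<le> prob (?D n) + prob (?G n)" by (rule measure_Un_le[OF evD evG])
    finally show ?thesis using d(2)[of n] n by (intro exI[of _ n]) simp
  qed
  then show ?thesis using d by (intro exI[of _ "\<delta> / 2"]) auto
qed

section \<open>The almost sure limit\<close>

text \<open>Off the almost sure event on which the process settles, the value is an arbitrary fixed tree.\<close>

definition limit_tree :: "'a \<Rightarrow> ltree" where
  "limit_tree \<omega> = (if settles x (choices \<omega>) then abs_ltree (limit_graph x (choices \<omega>))
     else abs_ltree single_vertex)"

lemma limit_tree_tendsto:
  "settles x (choices \<omega>) \<Longrightarrow> (\<lambda>n. uaf_tree x V n \<omega>) \<longlonglongrightarrow> limit_tree \<omega>"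
  using uaf_tendsto_limit_graph by (simp add: limit_tree_def uaf_tree_def)

lemma measurable_settles: "{\<omega> \<in> space M. settles x (choices \<omega>)} \<in> events"
proof -
  have "{\<omega> \<in> space M. settles x (choices \<omega>)} =
    (\<Inter>j. \<Union>m\<in>{j..}. {\<omega> \<in> space M. j \<notin> active (uaf x (choices \<omega>) m)})"
    by (auto simp: settles_def)
  moreover have "{\<omega> \<in> space M. j \<notin> active (uaf x (choices \<omega>) m)} \<in> events" for j m
    by (rule determined_event[of m]) (rule determined_uaf, simp)
  ultimately show ?thesis by (auto intro!: sets.countable_INT' sets.countable_UN')
qed

text \<open>An open set contains the limit tree if and only if it contains all extensions of some finite
  stage. This turns the preimage into a countable union of events that depend on finite histories.\<close>

lemma measurable_limit_tree: "limit_tree \<in> borel_measurable M"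
proof (rule borel_measurableI)
  fix U :: "ltree set" assume U: "open U"
  define P where "P s \<longleftrightarrow> (\<forall>t. locally_finite_tree t \<and> extends s t \<longrightarrow> abs_ltree t \<in> U)" for s
  let ?S = "{\<omega> \<in> space M. settles x (choices \<omega>)}"
  have "limit_tree \<omega> \<in> U \<longleftrightarrow> (\<exists>m. P (uaf x (choices \<omega>) m))" if S: "settles x (choices \<omega>)" for \<omega>
  proof
    assume "limit_tree \<omega> \<in> U"
    with extensions_in_open[OF S _ U, of "limit_tree \<omega>"] limit_tree_tendsto[OF S]
    have "\<forall>\<^sub>F m in sequentially. P (uaf x (choices \<omega>) m)" by (simp add: P_def uaf_tree_def)
    then show "\<exists>m. P (uaf x (choices \<omega>) m)" by (auto simp: eventually_sequentially)
  next
    assume "\<exists>m. P (uaf x (choices \<omega>) m)"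
    then show "limit_tree \<omega> \<in> U"
      using S tree_limit_graph[OF S] extends_limit_graph by (auto simp: P_def limit_tree_def)
  qed
  then have "limit_tree -` U \<inter> space M =
    (?S \<inter> (\<Union>m. {\<omega> \<in> space M. P (uaf x (choices \<omega>) m)})) \<union>
    (if abs_ltree single_vertex \<in> U then space M - ?S else {})"
    by (auto split: if_splits) (auto simp: limit_tree_def split: if_splits)
  moreover have "{\<omega> \<in> space M. P (uaf x (choices \<omega>) m)} \<in> events" for m
    by (rule determined_event[of m]) (rule determined_uaf, simp)
  ultimately show "limit_tree -` U \<inter> space M \<in> events"
    using measurable_settles by auto
qed

end

section \<open>Convergence in distribution\<close>

text \<open>Dominated convergence.\<close>

lemma converges_weakly_AE:
  assumes M: "prob_space M" and T: "T \<in> borel_measurable M" "\<And>n. X n \<in> borel_measurable M"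
    and L: "AE \<omega> in M. (\<lambda>n. X n \<omega>) \<longlonglongrightarrow> T \<omega>"
  shows "converges_weakly (\<lambda>n. distr M borel (X n)) (distr M borel T)"
  unfolding converges_weakly_def
proof (intro allI impI)
  interpret prob_space M by (rule M)
  fix f :: "'b \<Rightarrow> real" assume f: "continuous_on UNIV f \<and> bounded (range f)"
  then obtain C where C: "\<And>y. norm (f y) \<le> C" by (auto simp: bounded_iff)
  have fm: "f \<in> borel_measurable borel" using f by (intro borel_measurable_continuous_onI) auto
  have "(\<lambda>n. expectation (\<lambda>\<omega>. f (X n \<omega>))) \<longlonglongrightarrow> expectation (\<lambda>\<omega>. f (T \<omega>))"
  proof (rule integral_dominated_convergence[where w = "\<lambda>_. C"])
    show "AE \<omega> in M. (\<lambda>n. f (X n \<omega>)) \<longlonglongrightarrow> f (T \<omega>)"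
      using L by eventually_elim (use f in \<open>auto intro: continuous_on_tendsto_compose\<close>)
  qed (use T fm C in \<open>auto intro: measurable_compose\<close>)
  then show "(\<lambda>n. LINT y|distr M borel (X n). f y) \<longlonglongrightarrow> (LINT y|distr M borel T. f y)"
    using T fm by (simp add: integral_distr)
qed

text \<open>Under every probability measure the degree of the root is tight, being finite everywhere. The
  indicators are Borel functions because they are continuous.\<close>

lemma of_bool_root_degree_tendsto_0:
  assumes "prob_space \<mu>" "sets \<mu> = sets borel"
  shows "(\<lambda>k. LINT t|\<mu>. of_bool (k \<le> root_degree t) :: real) \<longlonglongrightarrow> 0"
proof -
  interpret prob_space \<mu> by fact
  have "(\<lambda>k. LINT t|\<mu>. of_bool (k \<le> root_degree t) :: real) \<longlonglongrightarrow> (LINT t|\<mu>. 0)"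
  proof (rule integral_dominated_convergence[where w = "\<lambda>_. 1"])
    have "(\<lambda>k. of_bool (k \<le> root_degree t) :: real) \<longlonglongrightarrow> 0" for t
      by (rule tendsto_eventually) (auto simp: eventually_sequentially intro!: exI[of _ "Suc (root_degree t)"])
    then show "AE t in \<mu>. (\<lambda>k. of_bool (k \<le> root_degree t) :: real) \<longlonglongrightarrow> 0" by simp
    show "(\<lambda>t. of_bool (k \<le> root_degree t) :: real) \<in> borel_measurable \<mu>" for k
      unfolding measurable_cong_sets[OF assms(2) refl]
      by (rule borel_measurable_continuous_onI) (rule continuous_on_root_degree)
  qed auto
  then show ?thesis by simp
qed

locale uaf_sequence = immortal_uaf N x W for N :: "'b measure" and x W +
  fixes M :: "nat \<Rightarrow> 'a measure" and xs :: "nat \<Rightarrow> nat \<Rightarrow> int" and V :: "nat \<Rightarrow> nat \<Rightarrow> 'a \<Rightarrow> nat"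
  assumes processes: "\<And>n. uaf_process (M n) (xs n) (V n)"
    and steps_tendsto: "\<And>i. i \<ge> 1 \<Longrightarrow> \<forall>\<^sub>F n in sequentially. xs n i = x i"
begin

definition law :: "nat \<Rightarrow> ltree measure" where
  "law n = distr (M n) borel (uaf_tree (xs n) (V n) n)"

lemma eventually_agree: "\<forall>\<^sub>F n in sequentially. \<forall>i\<in>{1..m}. xs n i = x i"
  by (intro eventually_ball_finite ballI steps_tendsto) auto

text \<open>As soon as the driving sequences agree up to time \<open>m\<close>, the first \<open>m\<close> choices have the same law
  in the \<open>n\<close>-th process as in the limiting one.\<close>

lemma expectation_eq:
  fixes F :: "(nat \<Rightarrow> nat) \<Rightarrow> real"
  assumes F: "determined m F" and n: "\<And>i. i \<in> {1..m} \<Longrightarrow> xs n i = x i"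
  shows "(LINT \<omega>|M n. F (\<lambda>i. V n i \<omega>)) = expectation (\<lambda>\<omega>. F (choices \<omega>))"
proof -
  interpret P: uaf_process "M n" "xs n" "V n" by (rule processes)
  interpret P: agreeing_uaf "M n" "xs n" "V n" x m
    by unfold_locales (use n steps immortal in auto)
  interpret Q: agreeing_uaf N x W x m by (rule agreeing_self)
  show ?thesis using P.expectation_determined[OF F] Q.expectation_determined[OF F] by simp
qed

lemma integral_law:
  fixes f :: "ltree \<Rightarrow> real"
  assumes "f \<in> borel_measurable borel"
  shows "(LINT t|law n. f t) = (LINT \<omega>|M n. f (abs_ltree (uaf (xs n) (\<lambda>i. V n i \<omega>) n)))"
proof -
  interpret P: uaf_process "M n" "xs n" "V n" by (rule processes)
  have "(LINT t|law n. f t) = (LINT \<omega>|M n. f (uaf_tree (xs n) (V n) n \<omega>))"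
    unfolding law_def by (rule integral_distr[OF measurable_uaf_tree[OF P.uniform] assms])
  then show ?thesis by (simp add: uaf_tree_def)
qed

text \<open>The degree of the root is a continuous function of the tree that can only grow with time. Its
  tail probabilities under the weak limit are therefore at least those of every fixed finite stage
  of the limiting process, which is too much if the rates are summable.\<close>

lemma weak_limit_not_summable:
  assumes mu: "prob_space \<mu>" "sets \<mu> = sets borel" and L: "converges_weakly law \<mu>"
  shows "\<not> summable (freeze_rate x)"
proof
  assume "summable (freeze_rate x)"
  then obtain \<delta> where d: "\<delta> > 0"
    "\<And>k. \<exists>m. \<delta> \<le> prob {\<omega> \<in> space N. k \<le> root_deg (uaf x (choices \<omega>) m)}"
    using root_degree_not_tight by blast
  have "\<delta> \<le> (LINT t|\<mu>. of_bool (k \<le> root_degree t))" for k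
  proof -
    let ?f = "\<lambda>t. of_bool (k \<le> root_degree t) :: real"
    have fc: "continuous_on UNIV ?f" by (rule continuous_on_root_degree)
    obtain m where m: "\<delta> \<le> prob {\<omega> \<in> space N. k \<le> root_deg (uaf x (choices \<omega>) m)}"
      using d(2) by blast
    have "\<forall>\<^sub>F n in sequentially. (\<forall>i\<in>{1..m}. xs n i = x i) \<and> m \<le> n"
      by (intro eventually_conj eventually_agree eventually_ge_at_top)
    then have "\<forall>\<^sub>F n in sequentially. \<delta> \<le> (LINT t|law n. ?f t)"
    proof eventually_elim
      case (elim n)
      interpret P: uaf_process "M n" "xs n" "V n" by (rule processes)
      let ?g = "\<lambda>v. of_bool (k \<le> root_deg (uaf x v m)) :: real"
      let ?h = "\<lambda>v. of_bool (k \<le> root_deg (uaf (xs n) v n)) :: real"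
      have dg: "determined m ?g" and dh: "determined n ?h"
        by (rule determined_uaf[where F = "\<lambda>t. of_bool (k \<le> root_deg t)"], simp)+
      have le: "?g v \<le> ?h v" for v
      proof -
        have "extends (uaf x v m) (uaf (xs n) v n)" by (rule extends_uaf) (use elim in auto)
        then show ?thesis using root_deg_mono[OF tree_uaf[of "xs n" v n]] by fastforce
      qed
      have "\<delta> \<le> expectation (\<lambda>\<omega>. ?g (choices \<omega>))"
      proof -
        have "?g (choices \<omega>) = indicator {\<omega> \<in> space N. k \<le> root_deg (uaf x (choices \<omega>) m)} \<omega>"
          if "\<omega> \<in> space N" for \<omega> using that by (simp add: indicator_def)
        then have "expectation (\<lambda>\<omega>. ?g (choices \<omega>)) =
          expectation (indicator {\<omega> \<in> space N. k \<le> root_deg (uaf x (choices \<omega>) m)})"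
          by (intro Bochner_Integration.integral_cong) auto
        also have "\<dots> = prob {\<omega> \<in> space N. k \<le> root_deg (uaf x (choices \<omega>) m)}"
          by (subst Bochner_Integration.integral_indicator) (auto intro!: arg_cong[of _ _ prob])
        finally show ?thesis using m by simp
      qed
      also have "\<dots> = (LINT \<omega>|M n. ?g (\<lambda>i. V n i \<omega>))"
        by (rule expectation_eq[OF dg, symmetric]) (use elim in auto)
      also have "\<dots> \<le> (LINT \<omega>|M n. ?h (\<lambda>i. V n i \<omega>))"
      proof (rule integral_mono[OF _ _ le])
        have "(\<lambda>\<omega>. ?g (\<lambda>i. V n i \<omega>)) \<in> borel_measurable (M n)"
          by (rule measurable_compose[OF P.measurable_determined[OF dg]]) simp
        then show "integrable (M n) (\<lambda>\<omega>. ?g (\<lambda>i. V n i \<omega>))"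
          by (intro P.integrable_const_bound[where B = 1]) simp_all
        have "(\<lambda>\<omega>. ?h (\<lambda>i. V n i \<omega>)) \<in> borel_measurable (M n)"
          by (rule measurable_compose[OF P.measurable_determined[OF dh]]) simp
        then show "integrable (M n) (\<lambda>\<omega>. ?h (\<lambda>i. V n i \<omega>))"
          by (intro P.integrable_const_bound[where B = 1]) simp_all
      qed
      also have "\<dots> = (LINT t|law n. ?f t)"
        by (subst integral_law)
          (auto simp: root_degree_abs tree_uaf intro!: borel_measurable_continuous_onI fc)
      finally show ?case .
    qed
    moreover have "(\<lambda>n. LINT t|law n. ?f t) \<longlonglongrightarrow> (LINT t|\<mu>. ?f t)"
      using L fc unfolding converges_weakly_def by (auto simp: bounded_iff intro!: exI[of _ 1])
    ultimately show ?thesis by (intro tendsto_lowerbound) auto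
  qed
  then have "\<delta> \<le> 0" by (intro LIMSEQ_le_const[OF of_bool_root_degree_tendsto_0[OF mu]]) auto
  then show False using d(1) by simp
qed

text \<open>Given a bounded continuous \<open>f\<close>, call a finite stage unstable if some extension changes the value
  of \<open>f\<close> by more than \<open>\<epsilon>\<close>. Almost surely, the stages of the limiting process are eventually
  stable. So there is a time \<open>m\<close> at which instability is unlikely, under the limiting process and
  hence, for large \<open>n\<close>, also under the \<open>n\<close>-th one. The tree of the latter at time \<open>n\<close> extends its
  tree at time \<open>m\<close>, whatever the steps after \<open>m\<close> are, so the two trees have nearly the same
  expectation of \<open>f\<close>.\<close>

lemma weak_limit:
  assumes ns: "\<not> summable (freeze_rate x)"
    and T: "T \<in> borel_measurable N" "AE \<omega> in N. (\<lambda>n. uaf_tree x W n \<omega>) \<longlonglongrightarrow> T \<omega>"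
  shows "converges_weakly law (distr N borel T)"
  unfolding converges_weakly_def
proof (intro allI impI)
  fix f :: "ltree \<Rightarrow> real" assume f: "continuous_on UNIV f \<and> bounded (range f)"
  then obtain C where C: "\<And>y. \<bar>f y\<bar> \<le> C" by (auto simp: bounded_iff)
  have C0: "0 \<le> C" using C[of undefined] by linarith
  have fc: "continuous_on UNIV f" using f by simp
  have fm: "f \<in> borel_measurable borel" using fc by (rule borel_measurable_continuous_onI)
  define F where "F m v = f (abs_ltree (uaf x v m))" for m v
  have dF: "determined m (F m)" for m unfolding F_def by (rule determined_uaf) simp
  have LF: "(\<lambda>m. expectation (\<lambda>\<omega>. F m (choices \<omega>))) \<longlonglongrightarrow> (LINT y|distr N borel T. f y)"
  proof -
    have "converges_weakly (\<lambda>n. distr N borel (uaf_tree x W n)) (distr N borel T)"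
      by (rule converges_weakly_AE[OF prob_space_axioms T(1) measurable_uaf_tree[OF uniform] T(2)])
    then have "(\<lambda>n. LINT y|distr N borel (uaf_tree x W n). f y) \<longlonglongrightarrow> (LINT y|distr N borel T. f y)"
      using f unfolding converges_weakly_def by blast
    then show ?thesis
      by (simp add: integral_distr[OF measurable_uaf_tree[OF uniform] fm] F_def uaf_tree_def)
  qed
  show "(\<lambda>n. LINT y|law n. f y) \<longlonglongrightarrow> (LINT y|distr N borel T. f y)"
  proof (rule LIMSEQ_I)
    fix r :: real assume r: "0 < r"
    \<comment> \<open>\<open>C\<close> bounds \<open>f\<close>; the errors add up to \<open>\<epsilon> + 2 * C * \<epsilon>\<close> from comparing the times \<open>m\<close> and \<open>n\<close>
      in the \<open>n\<close>-th process, and \<open>\<epsilon>\<close> from comparing the stage \<open>m\<close> of the limiting process to \<open>T\<close>.\<close>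
    define \<epsilon> where "\<epsilon> = r / (2 * C + 3)"
    have e: "0 < \<epsilon>" using r C0 by (simp add: \<epsilon>_def)
    have er: "(2 * C + 3) * \<epsilon> = r" using C0 by (simp add: \<epsilon>_def)
    define unstable where "unstable s \<longleftrightarrow>
      (\<exists>t. locally_finite_tree t \<and> extends s t \<and> \<epsilon> < \<bar>f (abs_ltree t) - f (abs_ltree s)\<bar>)"
      for s
    let ?B = "\<lambda>m v. of_bool (unstable (uaf x v m)) :: real"
    have dB: "determined m (?B m)" for m
      by (rule determined_uaf[where F = "\<lambda>t. of_bool (unstable t)"]) simp
    have stable: "AE \<omega> in N. \<forall>\<^sub>F m in sequentially. \<not> unstable (uaf x (choices \<omega>) m)"
      using AE_settles[OF ns] T(2)
    proof eventually_elim
      case (elim \<omega>)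
      let ?U = "f -` ball (f (T \<omega>)) (\<epsilon> / 2)"
      have L: "(\<lambda>n. abs_ltree (uaf x (choices \<omega>) n)) \<longlonglongrightarrow> T \<omega>" using elim by (simp add: uaf_tree_def)
      have U: "open ?U" "T \<omega> \<in> ?U" using open_vimage[OF open_ball fc] e by auto
      from extensions_in_open[OF elim(1) L U] show ?case
      proof eventually_elim
        case (elim m)
        have s: "abs_ltree (uaf x (choices \<omega>) m) \<in> ?U"
          using elim tree_uaf extends_refl by blast
        have "\<bar>f (abs_ltree t) - f (abs_ltree (uaf x (choices \<omega>) m))\<bar> \<le> \<epsilon>"
          if "locally_finite_tree t" "extends (uaf x (choices \<omega>) m) t" for t
        proof -
          have t: "abs_ltree t \<in> ?U" using elim that by blast
          have "dist (f (abs_ltree t)) (f (abs_ltree (uaf x (choices \<omega>) m))) < \<epsilon>"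
            by (rule dist_triangle_half_r[of "f (T \<omega>)"]) (use s t in simp_all)
          then show ?thesis by (simp add: dist_real_def)
        qed
        then show ?case unfolding unstable_def by (meson not_less)
      qed
    qed
    have "(\<lambda>m. expectation (\<lambda>\<omega>. ?B m (choices \<omega>))) \<longlonglongrightarrow> expectation (\<lambda>_. 0)"
    proof (rule integral_dominated_convergence[where w = "\<lambda>_. 1"])
      show "AE \<omega> in N. (\<lambda>m. ?B m (choices \<omega>)) \<longlonglongrightarrow> 0"
        using stable
      proof eventually_elim
        case (elim \<omega>)
        then have "\<forall>\<^sub>F m in sequentially. ?B m (choices \<omega>) = 0" by eventually_elim simp
        then show ?case by (rule tendsto_eventually)
      qed
      show "(\<lambda>\<omega>. ?B m (choices \<omega>)) \<in> borel_measurable N" for m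
        using measurable_determined[OF dB] by (rule measurable_compose) simp
    qed auto
    then have "\<forall>\<^sub>F m in sequentially. expectation (\<lambda>\<omega>. ?B m (choices \<omega>)) < \<epsilon>"
      using e by (intro order_tendstoD(2)[where y = 0]) auto
    moreover have "\<forall>\<^sub>F m in sequentially.
      dist (expectation (\<lambda>\<omega>. F m (choices \<omega>))) (LINT y|distr N borel T. f y) < \<epsilon>"
      using LF e by (rule tendstoD)
    ultimately have "\<forall>\<^sub>F m in sequentially. expectation (\<lambda>\<omega>. ?B m (choices \<omega>)) < \<epsilon> \<and>
      dist (expectation (\<lambda>\<omega>. F m (choices \<omega>))) (LINT y|distr N borel T. f y) < \<epsilon>"
      by (rule eventually_conj)
    then obtain m where mB: "expectation (\<lambda>\<omega>. ?B m (choices \<omega>)) < \<epsilon>"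
      and mF: "\<bar>expectation (\<lambda>\<omega>. F m (choices \<omega>)) - (LINT y|distr N borel T. f y)\<bar> < \<epsilon>"
      by (auto simp: eventually_sequentially dist_real_def)
    have "\<forall>\<^sub>F n in sequentially. (\<forall>i\<in>{1..m}. xs n i = x i) \<and> m \<le> n"
      by (intro eventually_conj eventually_agree eventually_ge_at_top)
    then have "\<forall>\<^sub>F n in sequentially. norm ((LINT y|law n. f y) - (LINT y|distr N borel T. f y)) < r"
    proof eventually_elim
      case (elim n)
      interpret P: uaf_process "M n" "xs n" "V n" by (rule processes)
      let ?V = "\<lambda>\<omega> i. V n i \<omega>"
      define G where "G v = f (abs_ltree (uaf (xs n) v n))" for v
      have dG: "determined n G" unfolding G_def by (rule determined_uaf) simp
      have mG: "(\<lambda>\<omega>. G (?V \<omega>)) \<in> borel_measurable (M n)"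
        and mFm: "(\<lambda>\<omega>. F m (?V \<omega>)) \<in> borel_measurable (M n)"
        and mBm: "(\<lambda>\<omega>. ?B m (?V \<omega>)) \<in> borel_measurable (M n)"
        by (rule measurable_compose[OF P.measurable_determined[OF dG]], simp,
          rule measurable_compose[OF P.measurable_determined[OF dF]], simp,
          rule measurable_compose[OF P.measurable_determined[OF dB]], simp)
      have iG: "integrable (M n) (\<lambda>\<omega>. G (?V \<omega>))"
        by (rule P.integrable_const_bound[where B = C, OF _ mG]) (simp add: G_def C)
      have iF: "integrable (M n) (\<lambda>\<omega>. F m (?V \<omega>))"
        by (rule P.integrable_const_bound[where B = C, OF _ mFm]) (simp add: F_def C)
      have iB: "integrable (M n) (\<lambda>\<omega>. ?B m (?V \<omega>))"
        by (rule P.integrable_const_bound[where B = 1, OF _ mBm]) simp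
      have ptw: "\<bar>G v - F m v\<bar> \<le> \<epsilon> + 2 * C * ?B m v" for v
      proof (cases "unstable (uaf x v m)")
        case True
        have "\<bar>G v - F m v\<bar> \<le> C + C"
          unfolding G_def F_def by (rule order_trans[OF abs_triangle_ineq4 add_mono[OF C C]])
        then show ?thesis using True e by simp
      next
        case False
        have "extends (uaf x v m) (uaf (xs n) v n)" by (rule extends_uaf) (use elim in auto)
        then have "\<bar>G v - F m v\<bar> \<le> \<epsilon>"
          using False tree_uaf unfolding unstable_def G_def F_def by (meson not_less)
        then show ?thesis using False by simp
      qed
      have "\<bar>(LINT \<omega>|M n. G (?V \<omega>)) - (LINT \<omega>|M n. F m (?V \<omega>))\<bar> =
        \<bar>LINT \<omega>|M n. G (?V \<omega>) - F m (?V \<omega>)\<bar>"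
        using iG iF by (simp add: Bochner_Integration.integral_diff)
      also have "\<dots> \<le> (LINT \<omega>|M n. \<bar>G (?V \<omega>) - F m (?V \<omega>)\<bar>)" by (rule integral_abs_bound)
      also have "\<dots> \<le> (LINT \<omega>|M n. \<epsilon> + 2 * C * ?B m (?V \<omega>))"
        by (intro integral_mono ptw) (use iG iF iB in auto)
      also have "\<dots> = \<epsilon> + 2 * C * (LINT \<omega>|M n. ?B m (?V \<omega>))"
        using iB by (simp add: P.prob_space)
      also have "(LINT \<omega>|M n. ?B m (?V \<omega>)) = expectation (\<lambda>\<omega>. ?B m (choices \<omega>))"
        by (rule expectation_eq[OF dB]) (use elim in auto)
      also have "\<epsilon> + 2 * C * \<dots> \<le> \<epsilon> + 2 * C * \<epsilon>"
        using mB C0 by (intro add_left_mono mult_left_mono) auto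
      finally have "\<bar>(LINT \<omega>|M n. G (?V \<omega>)) - (LINT \<omega>|M n. F m (?V \<omega>))\<bar> \<le> \<epsilon> + 2 * C * \<epsilon>" .
      moreover have "(LINT \<omega>|M n. F m (?V \<omega>)) = expectation (\<lambda>\<omega>. F m (choices \<omega>))"
        by (rule expectation_eq[OF dF]) (use elim in auto)
      moreover have "(LINT y|law n. f y) = (LINT \<omega>|M n. G (?V \<omega>))"
        unfolding G_def by (rule integral_law[OF fm])
      ultimately have "\<bar>(LINT y|law n. f y) - (LINT y|distr N borel T. f y)\<bar> < 2 * \<epsilon> + 2 * C * \<epsilon>"
        using mF by linarith
      also have "\<dots> < (2 * C + 3) * \<epsilon>" using e by (simp add: algebra_simps)
      finally show ?case unfolding er by simp
    qed
    then show "\<exists>no. \<forall>n\<ge>no. norm ((LINT y|law n. f y) - (LINT y|distr N borel T. f y)) < r"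
      by (simp add: eventually_sequentially)
  qed
qed

end

text \<open>Almost sure convergence implies weak convergence of the laws, so this is the preceding criterion
  for the constant sequence of processes.\<close>

lemma almost_sure_limit_not_summable:
  assumes "immortal_uaf N x W"
    and T: "T \<in> borel_measurable N" "AE \<omega> in N. (\<lambda>n. uaf_tree x W n \<omega>) \<longlonglongrightarrow> T \<omega>"
  shows "\<not> summable (freeze_rate x)"
proof -
  interpret immortal_uaf N x W by fact
  interpret S: uaf_sequence N x W "\<lambda>_. N" "\<lambda>_. x" "\<lambda>_. W"
    by unfold_locales simp_all
  show ?thesis
  proof (rule S.weak_limit_not_summable)
    show "prob_space (distr N borel T)" by (rule prob_space_distr[OF T(1)])
    have "S.law = (\<lambda>n. distr N borel (uaf_tree x W n))" by (rule ext) (rule S.law_def)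
    then show "converges_weakly S.law (distr N borel T)"
      using converges_weakly_AE[OF prob_space_axioms T(1) measurable_uaf_tree[OF uniform] T(2)] by simp
  qed simp
qed

theorem theorem1:
  fixes xs :: "nat \<Rightarrow> nat \<Rightarrow> int" and x :: "nat \<Rightarrow> int"
    and M :: "nat \<Rightarrow> 'a measure" and V :: "nat \<Rightarrow> nat \<Rightarrow> 'a \<Rightarrow> nat"
    and N :: "'b measure" and W :: "nat \<Rightarrow> 'b \<Rightarrow> nat"
  assumes "\<And>n i. i \<ge> 1 \<Longrightarrow> xs n i \<in> {- 1, 1}"
    and "\<And>i. i \<ge> 1 \<Longrightarrow> x i \<in> {- 1, 1}"
    and "\<tau> x = \<infinity>"
    and "\<And>i. i \<ge> 1 \<Longrightarrow> \<forall>\<^sub>F n in sequentially. xs n i = x i"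
    and "\<And>n. prob_space (M n)" and "\<And>n. uniform_choices (M n) (xs n) (V n)"
    and "prob_space N" and "uniform_choices N x W"
  defines "law \<equiv> \<lambda>n. distr (M n) borel (uaf_tree (xs n) (V n) n)"
    and "as_limit \<equiv> \<lambda>T :: 'b \<Rightarrow> ltree. T \<in> borel_measurable N \<and>
      (AE \<omega> in N. (\<lambda>n. uaf_tree x W n \<omega>) \<longlonglongrightarrow> T \<omega>)"
  defines "I \<equiv> \<exists>\<mu> :: ltree measure. prob_space \<mu> \<and> sets \<mu> = sets borel \<and> converges_weakly law \<mu>"
    and "II \<equiv> \<exists>T. as_limit T"
    and "III \<equiv> \<not> summable (\<lambda>i. 1 / real_of_int (walk x (Suc i)) * of_bool (x (Suc i) = - 1))"
  shows "(I \<longleftrightarrow> II) \<and> (II \<longleftrightarrow> III) \<and>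
    (\<forall>T. as_limit T \<longrightarrow> converges_weakly law (distr N borel T))"
proof -
  have P: "uaf_process (M n) (xs n) (V n)" for n
    using assms(5,6) by (simp add: uaf_process_def uaf_process_axioms_def)
  have Q: "immortal_uaf N x W"
    using assms(2,3,7,8)
    by (simp add: immortal_uaf_def immortal_uaf_axioms_def uaf_process_def uaf_process_axioms_def)
  interpret immortal_uaf N x W by (rule Q)
  interpret S: uaf_sequence N x W M xs V
    by (intro uaf_sequence.intro uaf_sequence_axioms.intro Q P assms(4))
  have law: "law = S.law" by (rule ext) (simp add: law_def S.law_def)
  have III: "III \<longleftrightarrow> \<not> summable (freeze_rate x)"
    unfolding III_def using summable_freeze_rate_iff[OF steps immortal] by simp
  have weak: "converges_weakly law (distr N borel T)" if "as_limit T" III for T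
    using that S.weak_limit unfolding law III as_limit_def by blast
  have II_III: "III" if "as_limit T" for T
    using that almost_sure_limit_not_summable[OF Q] unfolding III as_limit_def by blast
  have III_II: "as_limit limit_tree" if III
  proof -
    have "AE \<omega> in N. (\<lambda>n. uaf_tree x W n \<omega>) \<longlonglongrightarrow> limit_tree \<omega>"
      using AE_settles that unfolding III by (auto elim!: eventually_mono intro: limit_tree_tendsto)
    then show ?thesis using measurable_limit_tree by (simp add: as_limit_def)
  qed
  have I_III: "III" if I
    using that S.weak_limit_not_summable unfolding III I_def law by blast
  have II_I: I if "as_limit T" for T
  proof -
    have "prob_space (distr N borel T)" using that by (intro prob_space_distr) (simp add: as_limit_def)
    then show ?thesis unfolding I_def using weak[OF that II_III[OF that]] by (intro exI[of _ "distr N borel T"]) simp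
  qed
  show ?thesis unfolding II_def using weak II_III III_II I_III II_I by blast
qed

end
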